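(* Let $(\Omega,\mathcal F,\mathbb P,\theta)$ be an ergodic metric dynamical system with time set $\mathbb R$, let $H$ be a separable Hilbert space, and let $U$ be a linear random dynamical system on $H$ such that $U(t,\omega)$ is compact for all $t>0$, $\omega\in\Omega$, and $t\mapsto U(t,\omega)x$ is continuous on $[0,\infty)$ for all $x\in H$, $\omega\in\Omega$. Assume that $$D(\omega):=\log^+\sup_{t_1,t_2\in[0,1]}\|U(t_1,\theta_{t_2}\omega)\|\quad\text{satisfies}\quad \mathbb E D<\infty ,$$ and that $\lambda\in\mathbb R$ is not contained in the Lyapunov spectrum $\lambda_1>\lambda_2>\cdots$ of $U$. Suppose that $\lambda_1>\lambda$, let $\lambda_+$ be the smallest Lyapunov exponent bigger than $\lambda$ and let $\lambda_-$ be the biggest Lyapunov exponent smaller than $\lambda$. Let $H=E^u(\omega)\oplus E^s(\omega)$ be the splitting associated with $\lambda$ (see context), and let $U^u_\lambda(t,\omega)$, $U^s_\lambda(t,\omega)$ be the restrictions of $U(t,\omega)$ to $E^u(\omega)$, $E^s(\omega)$. Here $\Omega$ is understood to have been replaced by a suitable $\{\theta_t\}_{t\in\mathbb R}$-invariant subset of full measure (with the trace $\sigma$-algebra and the restricted measure), again denoted by $\Omega$. Then there exist a tempered random variable $K^s_\lambda(\omega)$ and a tempered from below random variable $K^u_\lambda(\omega)$ such that, for $t\ge 0$, $\omega\in\Omega$ and $\varepsilon>0$, $$\|U^u_\lambda(t,\omega)\|\ \ge\ K^u_\lambda(\omega)\,e^{(\lambda_+-\varepsilon)t},\qquad \|U^s_\lambda(t,\omega)\|\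 \le\ K^s_\lambda(\omega)\,e^{(\lambda_-+\varepsilon)t}.$$ Here $\|\cdot\|$ denotes the operator norm of $U_\lambda^{u/s}(t,\omega):E^{u/s}(\omega)\to E^{u/s}(\theta_t\omega)$.
   Context: Metric dynamical system: a probability space $(\Omega,\mathcal F,\mathbb P)$ with a measurable map $\theta:\mathbb R\times\Omega\to\Omega$, $\theta_t:=\theta(t,\cdot)$, with $\theta_0=\mathrm{id}$, $\theta_t\theta_s=\theta_{t+s}$, such that $\mathbb P$ is invariant and ergodic under $\theta$. Linear random dynamical system on $H$: a map $(t,\omega,x)\mapsto U(t,\omega)x$ from $[0,\infty)\times\Omega\times H$ to $H$, measurable with respect to $\mathcal B([0,\infty))\otimes\mathcal F\otimes\mathcal B(H)$, with each $U(t,\omega)$ a bounded linear operator, $U(0,\omega)=\mathrm{id}$ and $U(t+\tau,\omega)=U(t,\theta_\tau\omega)U(\tau,\omega)$ for $t,\tau\ge0$. Tempered: a random variable $X:\Omega\to(0,\infty)$ is tempered if $\lim_{t\to\infty}\frac{\log^+X(\theta_t\omega)}{t}=0$ for all $\omega$ in a $\{\theta_t\}_{t\in\mathbb R}$-invariant set of full measure; it is tempered from below if $X^{-1}$ is tempered. Lyapunov spectrum (given by the multiplicative ergodic theorem in Hilbert space, which applies under the integrability condition on $D$): there are finitely or infinitely many deterministic numbers $\lambda_1>\lambda_2>\cdots$ (the value $-\infty$ being possible) and linear subspaces $H=V_1\supset V_2(\omega)\supset\cdots$ of finite codimension independent of $\omega$, such that, for $\omega$ in a set of full measure that is forward invariant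 under $\theta$, $\lim_{t\to\infty}\frac1t\log\|U(t,\omega)x\|=\lambda_i$ for $x\in V_i(\omega)\setminus V_{i+1}(\omega)$, and $U(t,\omega)V_i(\omega)\subset V_i(\theta_t\omega)$ for $t\ge0$. The $\lambda_i$ are the Lyapunov exponents, and the set of them is the Lyapunov spectrum. Splitting associated with $\lambda$ (known to exist under the stated hypotheses): on a $\{\theta_t\}_{t\in\mathbb R}$-invariant set of full measure, $H=E^u(\omega)\oplus E^s(\omega)$, with measurable projections $\Pi^u(\omega),\Pi^s(\omega)$ onto $E^u(\omega),E^s(\omega)$; $E^u(\omega)$ has finite dimension independent of $\omega$; $U(t,\omega)E^u(\omega)=E^u(\theta_t\omega)$ and $U(t,\omega)E^s(\omega)\subset E^s(\theta_t\omega)$ for $t\ge0$; the restriction of $U(t,\omega)$ to $E^u(\omega)$ is invertible; $E^s(\omega)=V_i(\omega)$ if $\lambda_-=\lambda_i$; and for every $\varepsilon>0$ so small that $\lambda_+-\varepsilon>\lambda_-+\varepsilon$ and every $x$ there is $\tau(\omega,\varepsilon,x)$ such that for $t\ge\tau(\omega,\varepsilon,x)$: $\|U(t,\omega)x\|\ge\|x\|e^{(\lambda_+-\varepsilon)t}$ if $x\in E^u(\omega)$, and $\|U(t,\omega)x\|\le\|x\|e^{(\lambda_-+\varepsilon)t}$ if $x\in E^s(\omega)$.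
   Formalization: The random variables K^s and K^u may depend on ε (bounds with K independent of ε fail in general), and when λ_- = -∞, or no exponent lies below λ, the stable bound is read as holding with rate μ for every real μ, with K^s depending on μ. *)

theory Defs
  imports "HOL-Probability.Probability" "HOL-Library.Extended_Nat"
begin

section \<open>Metric dynamical systems and tempered random variables\<close>

locale metric_dynamical_system = prob_space M
  for M :: "'w measure" and \<theta> :: "real \<Rightarrow> 'w \<Rightarrow> 'w" +
  assumes flow_measurable: "(\<lambda>(t, \<omega>). \<theta> t \<omega>) \<in> borel \<Otimes>\<^sub>M M \<rightarrow>\<^sub>M M"
    and flow_zero: "\<And>\<omega>. \<omega> \<in> space M \<Longrightarrow> \<theta> 0 \<omega> = \<omega>"
    and flow_add: "\<And>t s \<omega>. \<omega> \<in> space M \<Longrightarrow> \<theta> t (\<theta> s \<omega>) = \<theta> (t + s) \<omega>"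
    and flow_invariant: "\<And>t. distr M M (\<theta> t) = M"

locale ergodic_metric_dynamical_system = metric_dynamical_system +
  assumes ergodic:
    "\<And>A. A \<in> sets M \<Longrightarrow> (\<And>t. \<theta> t -` A \<inter> space M = A) \<Longrightarrow> prob A = 0 \<or> prob A = 1"

definition full_measure :: "'w measure \<Rightarrow> 'w set \<Rightarrow> bool" where
  "full_measure M A \<longleftrightarrow> A \<in> sets M \<and> emeasure M A = 1"

definition invariant_full_measure :: "'w measure \<Rightarrow> (real \<Rightarrow> 'w \<Rightarrow> 'w) \<Rightarrow> 'w set \<Rightarrow> bool" where
  "invariant_full_measure M \<theta> A \<longleftrightarrow> full_measure M A \<and> (\<forall>t. \<theta> t ` A = A)"

definition forward_invariant_full_measure :: "'w measure \<Rightarrow> (real \<Rightarrow> 'w \<Rightarrow> 'w) \<Rightarrow> 'w set \<Rightarrow> bool" where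
  "forward_invariant_full_measure M \<theta> A \<longleftrightarrow> full_measure M A \<and> (\<forall>t\<ge>0. \<theta> t ` A \<subseteq> A)"

definition tempered :: "'w measure \<Rightarrow> (real \<Rightarrow> 'w \<Rightarrow> 'w) \<Rightarrow> ('w \<Rightarrow> real) \<Rightarrow> bool" where
  "tempered M \<theta> X \<longleftrightarrow>
     X \<in> borel_measurable M \<and> (\<forall>\<omega>\<in>space M. 0 < X \<omega>) \<and>
     (\<exists>A. invariant_full_measure M \<theta> A \<and>
        (\<forall>\<omega>\<in>A. ((\<lambda>t. max 0 (ln (X (\<theta> t \<omega>))) / t) \<longlongrightarrow> 0) at_top))"

definition tempered_from_below :: "'w measure \<Rightarrow> (real \<Rightarrow> 'w \<Rightarrow> 'w) \<Rightarrow> ('w \<Rightarrow> real) \<Rightarrow> bool" where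
  "tempered_from_below M \<theta> X \<longleftrightarrow>
     X \<in> borel_measurable M \<and> (\<forall>\<omega>\<in>space M. 0 < X \<omega>) \<and> tempered M \<theta> (\<lambda>\<omega>. inverse (X \<omega>))"

section \<open>Linear random dynamical systems\<close>

text \<open>The values of \<open>U\<close> at negative times and of \<open>U\<close>, \<open>\<theta>\<close> outside of the space
  of \<open>M\<close> are irrelevant.\<close>

locale linear_rds = ergodic_metric_dynamical_system M \<theta>
  for M :: "'w measure" and \<theta> +
  fixes U :: "real \<Rightarrow> 'w \<Rightarrow> 'h::{real_inner, complete_space, second_countable_topology} \<Rightarrow>\<^sub>L 'h"
  assumes U_measurable:
    "(\<lambda>(t, \<omega>, x). U t \<omega> x) \<in> borel_measurable (restrict_space borel {0..} \<Otimes>\<^sub>M M \<Otimes>\<^sub>M borel)"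
    and U_zero: "\<And>\<omega>. \<omega> \<in> space M \<Longrightarrow> U 0 \<omega> = id_blinfun"
    and U_cocycle: "\<And>t \<tau> \<omega>. 0 \<le> t \<Longrightarrow> 0 \<le> \<tau> \<Longrightarrow> \<omega> \<in> space M \<Longrightarrow>
           U (t + \<tau>) \<omega> = U t (\<theta> \<tau> \<omega>) o\<^sub>L U \<tau> \<omega>"

definition compact_operator :: "('h::real_normed_vector \<Rightarrow>\<^sub>L 'k::real_normed_vector) \<Rightarrow> bool" where
  "compact_operator T \<longleftrightarrow> compact (closure (blinfun_apply T ` cball 0 1))"

text \<open>Operator norm of the restriction of \<open>T\<close> to the subspace \<open>E\<close>; this is
  \<^const>\<open>onorm\<close> with the supremum restricted to \<open>E\<close>.\<close>

definition norm_on :: "('h::real_normed_vector \<Rightarrow>\<^sub>L 'k::real_normed_vector) \<Rightarrow> 'h set \<Rightarrow> real" where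
  "norm_on T E = (SUP x\<in>E. norm (T x) / norm x)"

definition ennreal_log_plus :: "ennreal \<Rightarrow> ennreal" where
  "ennreal_log_plus r = (if r = \<infinity> then \<infinity> else ennreal (max 0 (ln (enn2real r))))"

definition log_plus_sup ::
    "(real \<Rightarrow> 'w \<Rightarrow> 'w) \<Rightarrow> (real \<Rightarrow> 'w \<Rightarrow> 'h::real_normed_vector \<Rightarrow>\<^sub>L 'h) \<Rightarrow> 'w \<Rightarrow> ennreal" where
  "log_plus_sup \<theta> U \<omega> =
     ennreal_log_plus (SUP (t\<^sub>1, t\<^sub>2) \<in> {0..1} \<times> {0..1}. ennreal (norm (U t\<^sub>1 (\<theta> t\<^sub>2 \<omega>))))"

section \<open>Lyapunov spectrum\<close>

definition ereal_log :: "real \<Rightarrow> ereal" where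
  "ereal_log r = (if r \<le> 0 then - \<infinity> else ereal (ln r))"

definition has_dimension :: "'h::real_vector set \<Rightarrow> nat \<Rightarrow> bool" where
  "has_dimension S d \<longleftrightarrow> (\<exists>B. finite B \<and> card B = d \<and> independent B \<and> span B = S)"

definition has_codimension :: "'h::real_vector set \<Rightarrow> nat \<Rightarrow> bool" where
  "has_codimension S d \<longleftrightarrow>
     (\<exists>W. has_dimension W d \<and> W \<inter> S = {0} \<and> (\<forall>x. \<exists>w\<in>W. \<exists>s\<in>S. x = w + s))"

text \<open>\<open>p\<close> is the (finite or infinite) number of Lyapunov exponents, which are indexed from 1.\<close>

definition exponent_indices :: "enat \<Rightarrow> nat set" where
  "exponent_indices p = {i. 1 \<le> i \<and> enat i \<le> p}"

definition lyapunov_spectrum :: "enat \<Rightarrow> (nat \<Rightarrow> ereal) \<Rightarrow> ereal set" where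
  "lyapunov_spectrum p lam = lam ` exponent_indices p"

text \<open>The data supplied by the multiplicative ergodic theorem. If there are only finitely many
  exponents, then the space following the last one in the filtration is \<open>{0}\<close>. The finite
  codimension is only required of the spaces that belong to an exponent.\<close>

definition lyapunov_filtration ::
    "'w measure \<Rightarrow> (real \<Rightarrow> 'w \<Rightarrow> 'w) \<Rightarrow> (real \<Rightarrow> 'w \<Rightarrow> 'h::real_normed_vector \<Rightarrow>\<^sub>L 'h) \<Rightarrow>
     enat \<Rightarrow> (nat \<Rightarrow> ereal) \<Rightarrow> (nat \<Rightarrow> 'w \<Rightarrow> 'h set) \<Rightarrow> 'w set \<Rightarrow> bool" where
  "lyapunov_filtration M \<theta> U p lam V \<Omega>V \<longleftrightarrow>
     1 \<le> p \<and> lam 1 < \<infinity> \<and>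
     strict_antimono_on (exponent_indices p) lam \<and>
     forward_invariant_full_measure M \<theta> \<Omega>V \<and>
     (\<forall>\<omega>\<in>\<Omega>V. V 1 \<omega> = UNIV) \<and>
     (\<forall>q. p = enat q \<longrightarrow> (\<forall>\<omega>\<in>\<Omega>V. V (Suc q) \<omega> = {0})) \<and>
     (\<forall>i\<in>exponent_indices p.
        (\<exists>d. \<forall>\<omega>\<in>\<Omega>V. subspace (V i \<omega>) \<and> has_codimension (V i \<omega>) d) \<and>
        (\<forall>\<omega>\<in>\<Omega>V. V (Suc i) \<omega> \<subset> V i \<omega>) \<and>
        (\<forall>\<omega>\<in>\<Omega>V. \<forall>x \<in> V i \<omega> - V (Suc i) \<omega>.
           ((\<lambda>t. ereal (1 / t) * ereal_log (norm (U t \<omega> x))) \<longlongrightarrow> lam i) at_top) \<and>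
        (\<forall>\<omega>\<in>\<Omega>V. \<forall>t\<ge>0. U t \<omega> ` V i \<omega> \<subseteq> V i (\<theta> t \<omega>)))"

definition smallest_exponent_above :: "ereal set \<Rightarrow> real \<Rightarrow> real \<Rightarrow> bool" where
  "smallest_exponent_above S l lp \<longleftrightarrow>
     ereal lp \<in> S \<and> l < lp \<and> (\<forall>\<mu>\<in>S. ereal l < \<mu> \<longrightarrow> ereal lp \<le> \<mu>)"

text \<open>If there is no exponent below \<open>l\<close> (possible only in the degenerate case
  \<open>E\<^sup>s(\<omega>) = {0}\<close>, e.g. for finite-dimensional \<open>H\<close>), the value is \<open>-\<infinity>\<close> by convention.\<close>

definition biggest_exponent_below :: "ereal set \<Rightarrow> real \<Rightarrow> ereal \<Rightarrow> bool" where
  "biggest_exponent_below S l lm \<longleftrightarrow>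
     (if \<exists>\<mu>\<in>S. \<mu> < ereal l
      then lm \<in> S \<and> lm < ereal l \<and> (\<forall>\<mu>\<in>S. \<mu> < ereal l \<longrightarrow> \<mu> \<le> lm)
      else lm = - \<infinity>)"

section \<open>Splitting\<close>

text \<open>\<open>stable_rate lm \<epsilon> \<mu>\<close> says that \<open>\<mu>\<close> is a value of \<open>\<lambda>\<^sub>- + \<epsilon>\<close>. For \<open>\<lambda>\<^sub>- = -\<infinity>\<close>,
  a bound by \<open>exp ((\<lambda>\<^sub>- + \<epsilon>) t)\<close> means a bound by \<open>exp (\<mu> t)\<close> for every real \<open>\<mu>\<close>.\<close>

definition stable_rate :: "ereal \<Rightarrow> real \<Rightarrow> real \<Rightarrow> bool" where
  "stable_rate lm \<epsilon> \<mu> \<longleftrightarrow> lm = - \<infinity> \<or> ereal \<mu> = lm + ereal \<epsilon>"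

text \<open>\<open>lp\<close>, \<open>lm\<close> are \<open>\<lambda>\<^sub>+\<close>, \<open>\<lambda>\<^sub>-\<close>. The projections are bounded operators,
  measurable in the strong sense; \<open>\<Omega>V\<close> is the set on which the filtration \<open>V\<close> is given.\<close>

definition spectral_splitting ::
    "'w measure \<Rightarrow> (real \<Rightarrow> 'w \<Rightarrow> 'w) \<Rightarrow> (real \<Rightarrow> 'w \<Rightarrow> 'h::real_normed_vector \<Rightarrow>\<^sub>L 'h) \<Rightarrow>
     enat \<Rightarrow> (nat \<Rightarrow> ereal) \<Rightarrow> (nat \<Rightarrow> 'w \<Rightarrow> 'h set) \<Rightarrow> 'w set \<Rightarrow> real \<Rightarrow> ereal \<Rightarrow>
     ('w \<Rightarrow> 'h set) \<Rightarrow> ('w \<Rightarrow> 'h set) \<Rightarrow> ('w \<Rightarrow> 'h \<Rightarrow>\<^sub>L 'h) \<Rightarrow> ('w \<Rightarrow> 'h \<Rightarrow>\<^sub>L 'h) \<Rightarrow> 'w set \<Rightarrow> bool" where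
  "spectral_splitting M \<theta> U p lam V \<Omega>V lp lm Eu Es Pu Ps \<Omega>\<^sub>0 \<longleftrightarrow>
     invariant_full_measure M \<theta> \<Omega>\<^sub>0 \<and>
     (\<forall>x. (\<lambda>\<omega>. Pu \<omega> x) \<in> borel_measurable (restrict_space M \<Omega>\<^sub>0)) \<and>
     (\<forall>x. (\<lambda>\<omega>. Ps \<omega> x) \<in> borel_measurable (restrict_space M \<Omega>\<^sub>0)) \<and>
     (\<exists>d. \<forall>\<omega>\<in>\<Omega>\<^sub>0. has_dimension (Eu \<omega>) d) \<and>
     (\<forall>\<omega>\<in>\<Omega>\<^sub>0.
        subspace (Eu \<omega>) \<and> subspace (Es \<omega>) \<and>
        Eu \<omega> \<inter> Es \<omega> = {0} \<and> (\<forall>x. \<exists>u\<in>Eu \<omega>. \<exists>s\<in>Es \<omega>. x = u + s) \<and>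
        (\<forall>u\<in>Eu \<omega>. \<forall>s\<in>Es \<omega>. Pu \<omega> (u + s) = u \<and> Ps \<omega> (u + s) = s) \<and>
        (\<forall>t\<ge>0. bij_betw (U t \<omega>) (Eu \<omega>) (Eu (\<theta> t \<omega>)) \<and> U t \<omega> ` Es \<omega> \<subseteq> Es (\<theta> t \<omega>)) \<and>
        (\<forall>i\<in>exponent_indices p. lm = lam i \<and> \<omega> \<in> \<Omega>V \<longrightarrow> Es \<omega> = V i \<omega>) \<and>
        (\<forall>\<epsilon>>0. lm + ereal \<epsilon> < ereal (lp - \<epsilon>) \<longrightarrow>
           (\<forall>\<mu>. stable_rate lm \<epsilon> \<mu> \<longrightarrow>
             (\<forall>x. \<exists>\<tau>. \<forall>t\<ge>0. \<tau> \<le> t \<longrightarrow>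
                (x \<in> Eu \<omega> \<longrightarrow> norm x * exp ((lp - \<epsilon>) * t) \<le> norm (U t \<omega> x)) \<and>
                (x \<in> Es \<omega> \<longrightarrow> norm (U t \<omega> x) \<le> norm x * exp (\<mu> * t))))))"

end

theory Submission
  imports Defs
begin

text \<open>The random variables are the optimal ones: \<open>K\<^sup>s\<close> is the supremum of
  \<open>\<parallel>U\<^sup>s(t, \<omega>)\<parallel> exp (- \<mu> t)\<close> over \<open>t\<close> and \<open>K\<^sup>u\<close> the infimum of \<open>\<parallel>U\<^sup>u(t, \<omega>)\<parallel> exp (- r t)\<close>.
  The first is finite by the uniform boundedness principle, the second is positive because the finite-dimensional
  \<open>E\<^sup>u(\<omega>)\<close> is nonzero, as \<open>\<lambda>\<^sub>1 > \<lambda>\<close>, and its vectors grow at rate at least \<open>\<lambda>\<^sub>+\<close>. For temperedness, the cocycle property gives, for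
  \<open>s \<in> [0, 1]\<close>, \<open>ln K\<^sup>s(\<theta>\<^sub>s \<omega>) \<le> ln K\<^sup>s(\<theta>\<^sub>1 \<omega>) + g \<omega>\<close> and
  \<open>- ln K\<^sup>u(\<theta>\<^sub>s \<omega>) \<le> - ln K\<^sup>u(\<omega>) + g \<omega>\<close> with \<open>g\<close> equal to \<open>D\<close> plus a constant. A nonnegative \<open>f\<close>
  with such an integrable one-sided bound on its increments grows sublinearly along almost every
  orbit: between visits to \<open>A = {f \<le> C}\<close>, \<open>f\<close> is at most \<open>C\<close> plus the sum of \<open>1 + g\<close> over the
  current excursion from \<open>A\<close>, this sum is integrable as a function of the starting point of the
  excursion (Kac), and by Borel--Cantelli an integrable function grows sublinearly along orbits.\<close>

section \<open>Operator norms on subspaces\<close>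

text \<open>Baire's theorem: the closed sets \<open>F n\<close> on which the whole family is bounded
  by \<open>n\<close> cover the space, so one of them contains a ball. Every vector as long as its
  radius is a difference of two points of that ball.\<close>

lemma uniform_boundedness:
  fixes T :: "'i \<Rightarrow> 'a::{real_normed_vector, complete_space} \<Rightarrow>\<^sub>L 'b::real_normed_vector"
  assumes ptw: "\<And>x. \<exists>c. \<forall>i\<in>I. norm (T i x) \<le> c"
  shows "\<exists>c. \<forall>i\<in>I. norm (T i) \<le> c"
proof -
  define F where "F n = {x. \<forall>i\<in>I. norm (T i x) \<le> real n}" for n
  have clF: "closed (F n)" for n
  proof -
    have "F n = (\<Inter>i\<in>I. {x. norm (T i x) \<le> real n})"
      by (auto simp: F_def)
    moreover have "closed {x. norm (T i x) \<le> real n}" for i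
      by (intro closed_Collect_le continuous_intros)
    ultimately show ?thesis by auto
  qed
  have cover: "\<Union>(range F) = UNIV"
  proof -
    have "x \<in> \<Union>(range F)" for x
    proof -
      obtain c where c: "\<forall>i\<in>I. norm (T i x) \<le> c"
        using ptw by blast
      obtain n :: nat where "c \<le> real n"
        using real_arch_simple by blast
      with c have "x \<in> F n"
        unfolding F_def by force
      then show ?thesis by blast
    qed
    then show ?thesis by auto
  qed
  have "\<exists>n. interior (F n) \<noteq> {}"
  proof (rule ccontr)
    assume "\<not> ?thesis"
    then have "(euclidean :: 'a topology) interior_of \<Union>(range F) = {}"
      using clF by (intro Baire_category_alt) (auto simp: completely_metrizable_space_euclidean)
    then show False
      using cover by simp
  qed
  then obtain n x0 where "x0 \<in> interior (F n)" by blast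
  then obtain e where e: "e > 0" "cball x0 e \<subseteq> F n"
    using mem_interior_cball by blast
  have "norm (T i) \<le> 2 * real n / e" if i: "i \<in> I" for i
  proof (rule norm_blinfun_bound)
    fix y :: 'a
    show "norm (T i y) \<le> 2 * real n / e * norm y"
    proof (cases "y = 0")
      case False
      define z where "z = (e / norm y) *\<^sub>R y"
      have "norm z = e"
        using False e by (simp add: z_def)
      then have "x0 + z \<in> F n" "x0 \<in> F n"
        using e by (auto simp: dist_norm subset_iff)
      then have "norm (T i (x0 + z)) \<le> real n" "norm (T i x0) \<le> real n"
        using i by (auto simp: F_def)
      then have "norm (T i z) \<le> 2 * real n"
        using norm_triangle_ineq4[of "T i (x0 + z)" "T i x0"] by (simp add: blinfun.add_right)
      moreover have "norm (T i z) = e / norm y * norm (T i y)"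
        using e by (simp add: z_def blinfun.scaleR_right)
      ultimately show ?thesis
        using e False by (simp add: field_simps)
    qed (use e in auto)
  qed (use e in auto)
  then show ?thesis by blast
qed

text \<open>Makes the real-valued supremum in \<open>norm_on\<close> meaningful. The quotient at the
  zero vector is 0, since division by 0 gives 0.\<close>

lemma norm_on_bdd_above: "bdd_above ((\<lambda>x. norm (blinfun_apply T x) / norm x) ` E)"
proof (rule bdd_aboveI2)
  fix x show "norm (T x) / norm x \<le> norm T"
    using norm_blinfun[of T x] by (cases "x = 0") (auto simp: field_simps)
qed

lemma norm_on_apply: "x \<in> E \<Longrightarrow> norm (blinfun_apply T x) \<le> norm_on T E * norm x"
proof -
  assume "x \<in> E"
  then have "norm (T x) / norm x \<le> norm_on T E"
    unfolding norm_on_def by (rule cSUP_upper[OF _ norm_on_bdd_above])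
  then show ?thesis
    by (cases "x = 0") (auto simp: field_simps)
qed

text \<open>Nonnegativity of \<open>c\<close> matters for \<open>E = {0}\<close>, where the third
  assumption says nothing and the norm is 0.\<close>

lemma norm_on_le:
  assumes "E \<noteq> {}" "0 \<le> c" "\<And>x. x \<in> E \<Longrightarrow> norm (blinfun_apply T x) \<le> c * norm x"
  shows "norm_on T E \<le> c"
  unfolding norm_on_def
proof (rule cSUP_least)
  fix x assume "x \<in> E"
  then show "norm (T x) / norm x \<le> c"
    using assms(2) assms(3)[of x] by (cases "x = 0") (auto simp: field_simps)
qed (use assms in auto)

lemma norm_on_nonneg: "E \<noteq> {} \<Longrightarrow> 0 \<le> norm_on T E"
proof -
  assume "E \<noteq> {}"
  then obtain x where "x \<in> E" by blast
  have "0 \<le> norm (T x) / norm x" by simp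
  also have "\<dots> \<le> norm_on T E"
    unfolding norm_on_def by (rule cSUP_upper[OF \<open>x \<in> E\<close> norm_on_bdd_above])
  finally show ?thesis .
qed

lemma norm_on_le_norm: "E \<noteq> {} \<Longrightarrow> norm_on T E \<le> norm T"
  by (rule norm_on_le) (auto intro: norm_blinfun)

lemma norm_on_le_iff:
  assumes "E \<noteq> {}" "0 \<le> c"
  shows "norm_on T E \<le> c \<longleftrightarrow> (\<forall>x\<in>E. norm (blinfun_apply T x) \<le> c * norm x)"
proof
  assume "norm_on T E \<le> c"
  then show "\<forall>x\<in>E. norm (T x) \<le> c * norm x"
    using norm_on_apply[of _ E T] by (meson mult_right_mono norm_ge_zero order_trans)
qed (use norm_on_le assms in blast)

lemma norm_on_compose:
  assumes "E \<noteq> {}" "blinfun_apply S ` E \<subseteq> F"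
  shows "norm_on (T o\<^sub>L S) E \<le> norm_on T F * norm_on S E"
proof (rule norm_on_le)
  have F: "F \<noteq> {}" using assms by auto
  show "0 \<le> norm_on T F * norm_on S E"
    by (intro mult_nonneg_nonneg norm_on_nonneg assms F)
  fix x assume x: "x \<in> E"
  have "norm ((T o\<^sub>L S) x) \<le> norm_on T F * norm (S x)"
    using assms x by (auto intro!: norm_on_apply)
  also have "\<dots> \<le> norm_on T F * (norm_on S E * norm x)"
    using x by (intro mult_left_mono norm_on_apply norm_on_nonneg F)
  finally show "norm ((T o\<^sub>L S) x) \<le> norm_on T F * norm_on S E * norm x"
    by simp
qed fact

lemma norm_on_le_add:
  assumes "E \<noteq> {}"
  shows "norm_on T E \<le> norm_on S E + norm_on (T - S) E"
proof (rule norm_on_le)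
  show "0 \<le> norm_on S E + norm_on (T - S) E"
    by (intro add_nonneg_nonneg norm_on_nonneg assms)
  fix x assume x: "x \<in> E"
  have "norm (T x) \<le> norm (S x) + norm ((T - S) x)"
    using norm_triangle_sub[of "T x" "S x"] by (simp add: blinfun.diff_left)
  also have "\<dots> \<le> norm_on S E * norm x + norm_on (T - S) E * norm x"
    using x by (intro add_mono norm_on_apply)
  finally show "norm (T x) \<le> (norm_on S E + norm_on (T - S) E) * norm x"
    by (simp add: distrib_right)
qed fact

text \<open>The inner product with a member of \<open>C\<close> isolates its coefficient.
  \<open>C\<close> may contain 0: that term vanishes whatever the coefficient.\<close>

lemma orthogonal_expansion:
  fixes C :: "'a::real_inner set"
  assumes "finite C" "pairwise orthogonal C" "x \<in> span C"
  shows "x = (\<Sum>c\<in>C. ((x \<bullet> c) / (c \<bullet> c)) *\<^sub>R c)"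
proof -
  obtain r where r: "x = (\<Sum>c\<in>C. r c *\<^sub>R c)"
    using assms by (auto simp: span_finite)
  have "x \<bullet> c = r c * (c \<bullet> c)" if "c \<in> C" for c
  proof -
    have "x \<bullet> c = (\<Sum>b\<in>C. r b * (b \<bullet> c))"
      by (simp add: r inner_sum_left)
    also have "\<dots> = (\<Sum>b\<in>C. if b = c then r c * (c \<bullet> c) else 0)"
      using assms(2) that by (intro sum.cong) (auto simp: pairwise_def orthogonal_def)
    finally show ?thesis
      using assms(1) that by simp
  qed
  then have "(\<Sum>c\<in>C. ((x \<bullet> c) / (c \<bullet> c)) *\<^sub>R c) = (\<Sum>c\<in>C. r c *\<^sub>R c)"
    by (intro sum.cong) auto
  with r show ?thesis by simp
qed

text \<open>Cauchy-Schwarz bounds the coefficients of an orthogonal expansion by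
  \<open>norm x / norm c\<close>. Since \<open>C\<close> depends on \<open>E\<close> alone, strong
  convergence of operators becomes convergence in norm on \<open>E\<close>.\<close>

lemma norm_on_le_sum:
  fixes E :: "'a::real_inner set"
  assumes "has_dimension E d"
  obtains C where "finite C" "\<And>T :: 'a \<Rightarrow>\<^sub>L 'b::real_normed_vector. norm_on T E \<le> (\<Sum>c\<in>C. norm (T c) / norm c)"
proof -
  obtain B where "finite B" "span B = E"
    using assms by (auto simp: has_dimension_def)
  then obtain C where C: "finite C" "span C = E" "pairwise orthogonal C"
    using basis_orthogonal by metis
  have "norm_on T E \<le> (\<Sum>c\<in>C. norm (T c) / norm c)" for T :: "'a \<Rightarrow>\<^sub>L 'b"
  proof (rule norm_on_le)
    show "E \<noteq> {}" using C span_zero by blast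
    show "0 \<le> (\<Sum>c\<in>C. norm (T c) / norm c)" by (simp add: sum_nonneg)
    fix x assume "x \<in> E"
    then have "T x = (\<Sum>c\<in>C. ((x \<bullet> c) / (c \<bullet> c)) *\<^sub>R T c)"
      using orthogonal_expansion[of C x] C
      by (metis (no_types, lifting) blinfun.scaleR_right blinfun.sum_right sum.cong)
    also have "norm \<dots> \<le> (\<Sum>c\<in>C. norm (T c) / norm c * norm x)"
    proof (rule sum_norm_le)
      fix c
      have "norm (((x \<bullet> c) / (c \<bullet> c)) *\<^sub>R T c) = \<bar>x \<bullet> c\<bar> / (norm c * norm c) * norm (T c)"
        by (simp add: power2_norm_eq_inner[symmetric] power2_eq_square)
      also have "\<dots> \<le> (norm x * norm c) / (norm c * norm c) * norm (T c)"
        by (intro mult_right_mono divide_right_mono Cauchy_Schwarz_ineq2) auto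
      also have "\<dots> = norm (T c) / norm c * norm x" by simp
      finally show "norm (((x \<bullet> c) / (c \<bullet> c)) *\<^sub>R T c) \<le> norm (T c) / norm c * norm x" .
    qed
    finally show "norm (T x) \<le> (\<Sum>c\<in>C. norm (T c) / norm c) * norm x"
      by (simp add: sum_distrib_right)
  qed
  with C that show ?thesis by blast
qed

section \<open>Sublinear growth along orbits\<close>

context metric_dynamical_system
begin

lemma flow_measurable_fixed [measurable]: "\<theta> t \<in> M \<rightarrow>\<^sub>M M"
proof -
  have "(\<lambda>\<omega>. (t, \<omega>)) \<in> M \<rightarrow>\<^sub>M borel \<Otimes>\<^sub>M M" by measurable
  from measurable_compose[OF this flow_measurable] show ?thesis by simp
qed

lemma flow_pair_measurable:
  assumes [measurable]: "h \<in> borel_measurable N" "k \<in> N \<rightarrow>\<^sub>M M"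
  shows "(\<lambda>x. \<theta> (h x) (k x)) \<in> N \<rightarrow>\<^sub>M M"
proof -
  have "(\<lambda>x. (h x, k x)) \<in> N \<rightarrow>\<^sub>M borel \<Otimes>\<^sub>M M" by measurable
  from measurable_compose[OF this flow_measurable] show ?thesis by simp
qed

lemma flow_space: "\<omega> \<in> space M \<Longrightarrow> \<theta> t \<omega> \<in> space M"
  using measurable_space[of "\<theta> t" M M \<omega>] by simp

lemma nn_integral_flow:
  assumes "f \<in> borel_measurable M"
  shows "(\<integral>\<^sup>+\<omega>. f (\<theta> t \<omega>) \<partial>M) = (\<integral>\<^sup>+\<omega>. f \<omega> \<partial>M)"
  using nn_integral_distr[of "\<theta> t" M M f] assms by (simp add: flow_invariant)

lemma AE_flow:
  assumes "AE \<omega> in M. P \<omega>"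
  shows "AE \<omega> in M. P (\<theta> t \<omega>)"
proof -
  have "AE \<omega> in distr M M (\<theta> t). P \<omega>"
    unfolding flow_invariant by fact
  then show ?thesis
    by (rule AE_distrD[rotated]) measurable
qed

section \<open>Invariant sets of full measure\<close>

text \<open>A set of full measure need not contain an invariant set of full measure. The points
  whose orbit lies in the measurable set \<open>B\<close> of good points at almost every time do
  form one: Lebesgue measure is translation invariant, and Fubini gives full measure. One good time
  per orbit is enough for limits as time tends to infinity.\<close>

lemma AE_imp_invariant_full_measure:
  assumes "AE \<omega> in M. P \<omega>"
  obtains A where "invariant_full_measure M \<theta> A" "\<And>\<omega>. \<omega> \<in> A \<Longrightarrow> \<exists>t. P (\<theta> t \<omega>)"
proof -
  obtain N where N: "{\<omega> \<in> space M. \<not> P \<omega>} \<subseteq> N" "N \<in> null_sets M"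
    using assms by (auto simp: eventually_ae_filter)
  define B where "B = space M - N"
  have [measurable]: "B \<in> sets M" using N by (auto simp: B_def)
  have AEB: "AE \<omega> in M. \<omega> \<in> B"
    using N AE_not_in[OF N(2)] by (auto simp: B_def elim!: eventually_elim2)
  have swap [measurable]: "(\<lambda>p. \<theta> (snd p) (fst p)) \<in> M \<Otimes>\<^sub>M borel \<rightarrow>\<^sub>M M"
    by (rule flow_pair_measurable) measurable
  define A where "A = {\<omega> \<in> space M. AE t in lborel. \<theta> t \<omega> \<in> B}"
  interpret pair_sigma_finite lborel M by unfold_locales
  interpret P: pair_sigma_finite M lborel by unfold_locales
  have swap' [measurable]: "(\<lambda>p. \<theta> (fst p) (snd p)) \<in> borel \<Otimes>\<^sub>M M \<rightarrow>\<^sub>M M"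
    by (rule flow_pair_measurable) measurable
  have A[measurable]: "A \<in> sets M"
  proof -
    \<comment> \<open>Writing the condition as a vanishing integral over time makes it measurable in
      \<omega>.\<close>
    have "A = {\<omega> \<in> space M. (\<integral>\<^sup>+t. indicator (- B) (\<theta> t \<omega>) \<partial>lborel) = 0}"
      unfolding A_def
    proof (intro Collect_cong conj_cong refl)
      fix \<omega> assume "\<omega> \<in> space M"
      then have [measurable]: "(\<lambda>t. \<theta> t \<omega>) \<in> borel \<rightarrow>\<^sub>M M"
        by (intro flow_pair_measurable) auto
      have "(\<lambda>t. indicator (- B) (\<theta> t \<omega>) :: ennreal) \<in> borel_measurable lborel"
        unfolding indicator_def by measurable
      from nn_integral_0_iff_AE[OF this]
      show "(AE t in lborel. \<theta> t \<omega> \<in> B) \<longleftrightarrow> (\<integral>\<^sup>+t. indicator (- B) (\<theta> t \<omega>) \<partial>lborel) = 0"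
        by (simp add: indicator_def)
    qed
    moreover have "\<dots> \<in> sets M" by measurable
    ultimately show ?thesis by simp
  qed
  have "AE t in lborel. AE \<omega> in M. \<theta> t \<omega> \<in> B"
    using AE_flow[OF AEB] by simp
  then have "AE \<omega> in M. AE t in lborel. \<theta> t \<omega> \<in> B"
    by (subst (asm) AE_commute) measurable
  then have "AE \<omega> in M. \<omega> \<in> A"
    by (rule AE_mp) (auto simp: A_def)
  then have full: "full_measure M A"
    using A emeasure_eq_1_AE by (auto simp: full_measure_def)
  have inv: "\<theta> s \<omega> \<in> A" if "\<omega> \<in> A" for s \<omega>
  proof -
    from that have \<omega>: "\<omega> \<in> space M" "AE t in lborel. \<theta> t \<omega> \<in> B" by (auto simp: A_def)
    have "AE t in distr lborel borel ((+) s). \<theta> t \<omega> \<in> B"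
      unfolding lborel_distr_plus by fact
    then have "AE t in lborel. \<theta> (s + t) \<omega> \<in> B"
      by (rule AE_distrD[rotated]) measurable
    then show ?thesis
      using \<omega> by (auto simp: A_def flow_add flow_space add.commute)
  qed
  have "\<theta> s ` A = A" for s
  proof
    show "A \<subseteq> \<theta> s ` A"
    proof
      fix \<omega> assume "\<omega> \<in> A"
      then have "\<omega> = \<theta> s (\<theta> (- s) \<omega>)" "\<theta> (- s) \<omega> \<in> A"
        using inv[of \<omega> "- s"] by (auto simp: A_def flow_add flow_zero)
      then show "\<omega> \<in> \<theta> s ` A" by blast
    qed
  qed (use inv in blast)
  moreover have "\<exists>t. P (\<theta> t \<omega>)" if "\<omega> \<in> A" for \<omega>
  proof -
    from that have "\<omega> \<in> space M" "AE t in lborel. \<theta> t \<omega> \<in> B" by (auto simp: A_def)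
    \<comment> \<open>Lebesgue measure is not zero, so a property of almost every time holds at some
      time.\<close>
    moreover have "ae_filter (lborel :: real measure) \<noteq> bot"
      by (simp add: ae_filter_eq_bot_iff)
    ultimately obtain t where "\<theta> t \<omega> \<in> B"
      using eventually_happens by blast
    then show ?thesis using N by (auto simp: B_def)
  qed
  ultimately show ?thesis
    using full by (intro that[of A]) (auto simp: invariant_full_measure_def)
qed

text \<open>Borel-Cantelli: by invariance the events that
  \<open>S (\<theta> (real k) \<omega>)\<close> exceeds \<open>\<delta> * real k\<close> have total
  probability at most 1 plus the integral of \<open>S\<close> divided by \<delta>, so almost surely
  only finitely many of them occur.\<close>

lemma AE_orbit_sublinear:
  assumes [measurable]: "S \<in> borel_measurable M" and int: "(\<integral>\<^sup>+\<omega>. S \<omega> \<partial>M) < \<infinity>" and "0 < \<delta>"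
  shows "AE \<omega> in M. \<exists>c::real. \<forall>k::nat. S (\<theta> (real k) \<omega>) \<le> ennreal (c + \<delta> * real k)"
proof -
  \<comment> \<open>For finite \<open>s\<close> at most \<lceil>s / \<delta>\<rceil> indices
    contribute, counted from 0; rounding up costs the summand 1.\<close>
  have count: "(\<Sum>k. indicator {x. ennreal (\<delta> * real k) < x} s) \<le> 1 + ennreal (1 / \<delta>) * s" for s :: ennreal
  proof (cases s)
    case (real r)
    define n where "n = nat \<lceil>r / \<delta>\<rceil>"
    have "(\<Sum>k. indicator {x. ennreal (\<delta> * real k) < x} s :: ennreal)
        = (\<Sum>k<n. indicator {x. ennreal (\<delta> * real k) < x} s)"
    proof (rule suminf_finite)
      fix k assume "k \<notin> {..<n}"
      then have "r / \<delta> \<le> real k" unfolding n_def by (simp add: not_less)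
      then have "r \<le> \<delta> * real k" using \<open>0 < \<delta>\<close> by (simp add: field_simps)
      then show "indicator {x. ennreal (\<delta> * real k) < x} s = (0::ennreal)"
        using real by (auto simp: indicator_def not_less intro!: ennreal_leI)
    qed simp
    also have "\<dots> \<le> (\<Sum>k<n. 1)" by (intro sum_mono) (auto simp: indicator_def)
    also have "\<dots> = ennreal (real n)" by (simp add: ennreal_of_nat_eq_real_of_nat)
    also have "\<dots> \<le> ennreal (1 + 1 / \<delta> * r)"
    proof (rule ennreal_leI)
      have "0 \<le> r / \<delta>" using real \<open>0 < \<delta>\<close> by simp
      then show "real n \<le> 1 + 1 / \<delta> * r" unfolding n_def by simp linarith
    qed
    also have "\<dots> = 1 + ennreal (1 / \<delta>) * s"
      using real \<open>0 < \<delta>\<close> by (simp add: ennreal_mult[symmetric])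
    finally show ?thesis .
  qed (use \<open>0 < \<delta>\<close> in \<open>simp add: ennreal_mult_top\<close>)
  define N where "N k = {\<omega> \<in> space M. ennreal (\<delta> * real k) < S (\<theta> (real k) \<omega>)}" for k :: nat
  have [measurable]: "N k \<in> sets M" for k unfolding N_def by measurable
  have "(\<Sum>k. emeasure M (N k)) = (\<Sum>k::nat. \<integral>\<^sup>+\<omega>. indicator {x. ennreal (\<delta> * real k) < x} (S \<omega>) \<partial>M)"
  proof (intro arg_cong[where f = suminf] ext)
    fix k :: nat
    have "emeasure M (N k) = (\<integral>\<^sup>+\<omega>. indicator (N k) \<omega> \<partial>M)" by simp
    also have "\<dots> = (\<integral>\<^sup>+\<omega>. indicator {x. ennreal (\<delta> * real k) < x} (S (\<theta> (real k) \<omega>)) \<partial>M)"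
      by (intro nn_integral_cong) (auto simp: N_def indicator_def)
    also have "\<dots> = (\<integral>\<^sup>+\<omega>. indicator {x. ennreal (\<delta> * real k) < x} (S \<omega>) \<partial>M)"
      by (rule nn_integral_flow) measurable
    finally show "emeasure M (N k) = (\<integral>\<^sup>+\<omega>. indicator {x. ennreal (\<delta> * real k) < x} (S \<omega>) \<partial>M)" .
  qed
  also have "\<dots> = (\<integral>\<^sup>+\<omega>. (\<Sum>k::nat. indicator {x. ennreal (\<delta> * real k) < x} (S \<omega>)) \<partial>M)"
    by (rule nn_integral_suminf[symmetric]) measurable
  also have "\<dots> \<le> (\<integral>\<^sup>+\<omega>. 1 + ennreal (1 / \<delta>) * S \<omega> \<partial>M)"
    by (intro nn_integral_mono count)
  also have "\<dots> = 1 + ennreal (1 / \<delta>) * (\<integral>\<^sup>+\<omega>. S \<omega> \<partial>M)"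
    by (simp add: nn_integral_add nn_integral_cmult emeasure_space_1)
  also have "\<dots> < \<infinity>"
    using int by (simp add: ennreal_mult_less_top)
  finally have "summable (\<lambda>k. measure M (N k))"
    by (intro summable_suminf_not_top) (auto simp: emeasure_eq_measure)
  then have "AE \<omega> in M. eventually (\<lambda>k. \<omega> \<in> space M - N k) sequentially"
    by (intro borel_cantelli_AE1) (auto simp: less_top[symmetric])
  \<comment> \<open>Finiteness along the whole integer orbit lets the constant absorb the finitely
    many exceptional times.\<close>
  moreover have "AE \<omega> in M. S \<omega> \<noteq> \<infinity>"
    using int by (intro nn_integral_PInf_AE) auto
  then have "AE \<omega> in M. \<forall>k::nat. S (\<theta> (real k) \<omega>) \<noteq> \<infinity>"
    unfolding AE_all_countable by (intro allI AE_flow)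
  ultimately show ?thesis
  proof eventually_elim
    case (elim \<omega>)
    define s where "s k = enn2real (S (\<theta> (real k) \<omega>))" for k :: nat
    have s: "S (\<theta> (real k) \<omega>) = ennreal (s k)" "0 \<le> s k" for k
      using elim(2) by (auto simp: s_def less_top)
    obtain K where K: "\<And>k. k \<ge> K \<Longrightarrow> \<omega> \<in> space M - N k"
      using elim(1) by (auto simp: eventually_sequentially)
    have "s k \<le> sum s {..<K} + \<delta> * real k" for k
    proof (cases "k < K")
      case True
      then have "s k \<le> sum s {..<K}"
        using s by (intro member_le_sum) auto
      then show ?thesis
        using \<open>0 < \<delta>\<close> by (simp add: add_increasing2)
    next
      case False
      then have "S (\<theta> (real k) \<omega>) \<le> ennreal (\<delta> * real k)"
        using K[of k] by (auto simp: N_def)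
      then have "s k \<le> \<delta> * real k"
        using s \<open>0 < \<delta>\<close> by simp
      then show ?thesis
        using s by (simp add: add_increasing sum_nonneg)
    qed
    then have "\<forall>k. S (\<theta> (real k) \<omega>) \<le> ennreal (sum s {..<K} + \<delta> * real k)"
      using s by (auto intro: ennreal_leI)
    then show ?case by blast
  qed
qed

section \<open>Sums over excursions from a set\<close>

text \<open>Kac's return-time sum: from a point of \<open>A\<close>, \<open>g\<close> is added up
  along the integer orbit until just before the first return, and forever if there is none. A series
  with a condition in each term can be integrated termwise without a return-time function.\<close>

definition excursion_sum :: "'w set \<Rightarrow> ('w \<Rightarrow> ennreal) \<Rightarrow> 'w \<Rightarrow> ennreal" where
  "excursion_sum A g \<omega> =
     (\<Sum>j. if \<omega> \<in> A \<and> (\<forall>i\<in>{1..j}. \<theta> (real i) \<omega> \<notin> A) then g (\<theta> (real j) \<omega>) else 0)"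

lemma measurable_excursion_sum [measurable]:
  assumes [measurable]: "A \<in> sets M" "g \<in> borel_measurable M"
  shows "excursion_sum A g \<in> borel_measurable M"
  unfolding excursion_sum_def by measurable

text \<open>Kac's argument: shifting the \<open>j\<close>-th term back by \<open>j\<close> turns the sum into \<open>g\<close> times the
  indicator of the event that the last visit to \<open>A\<close> happened at some finite time.\<close>

lemma nn_integral_excursion_sum_le:
  assumes [measurable]: "A \<in> sets M" "g \<in> borel_measurable M"
  shows "(\<integral>\<^sup>+\<omega>. excursion_sum A g \<omega> \<partial>M) \<le> (\<integral>\<^sup>+\<omega>. g \<omega> \<partial>M)"
proof -
  \<comment> \<open>\<open>Q j\<close> says that the last visit to \<open>A\<close> at an integer
    time up to 0 took place \<open>j\<close> steps ago. It is the condition of the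
    \<open>j\<close>-th term, seen from the end point of the shift.\<close>
  define Q where "Q j \<omega> \<longleftrightarrow> \<theta> (- real j) \<omega> \<in> A \<and> (\<forall>i\<in>{1..j}. \<theta> (real i - real j) \<omega> \<notin> A)"
    for j :: nat and \<omega>
  have [measurable]: "Measurable.pred M (Q j)" for j unfolding Q_def by measurable
  have unique: "j = j'" if "Q j \<omega>" "Q j' \<omega>" for j j' \<omega>
  proof -
    have "\<not> a < b" if "Q a \<omega>" "Q b \<omega>" for a b
    proof
      assume "a < b"
      then have "b - a \<in> {1..b}" "real (b - a) - real b = - real a" by auto
      then show False using that unfolding Q_def by metis
    qed
    from this[of j j'] this[of j' j] that show ?thesis by auto
  qed
  have "(\<integral>\<^sup>+\<omega>. excursion_sum A g \<omega> \<partial>M)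
      = (\<Sum>j. \<integral>\<^sup>+\<omega>. (if \<omega> \<in> A \<and> (\<forall>i\<in>{1..j}. \<theta> (real i) \<omega> \<notin> A) then g (\<theta> (real j) \<omega>) else 0) \<partial>M)"
    unfolding excursion_sum_def by (rule nn_integral_suminf) measurable
  also have "\<dots> = (\<Sum>j. \<integral>\<^sup>+\<omega>. (if Q j \<omega> then g \<omega> else 0) \<partial>M)"
  proof (intro arg_cong[where f = suminf] ext)
    fix j
    have "(\<integral>\<^sup>+\<omega>. (if Q j (\<theta> (real j) \<omega>) then g (\<theta> (real j) \<omega>) else 0) \<partial>M)
        = (\<integral>\<^sup>+\<omega>. (if Q j \<omega> then g \<omega> else 0) \<partial>M)"
      by (rule nn_integral_flow) measurable
    moreover have "(\<integral>\<^sup>+\<omega>. (if Q j (\<theta> (real j) \<omega>) then g (\<theta> (real j) \<omega>) else 0) \<partial>M)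
        = (\<integral>\<^sup>+\<omega>. (if \<omega> \<in> A \<and> (\<forall>i\<in>{1..j}. \<theta> (real i) \<omega> \<notin> A) then g (\<theta> (real j) \<omega>) else 0) \<partial>M)"
      by (intro nn_integral_cong) (simp add: Q_def flow_add flow_zero)
    ultimately show "(\<integral>\<^sup>+\<omega>. (if \<omega> \<in> A \<and> (\<forall>i\<in>{1..j}. \<theta> (real i) \<omega> \<notin> A) then g (\<theta> (real j) \<omega>) else 0) \<partial>M)
        = (\<integral>\<^sup>+\<omega>. (if Q j \<omega> then g \<omega> else 0) \<partial>M)" by simp
  qed
  also have "\<dots> = (\<integral>\<^sup>+\<omega>. (\<Sum>j. if Q j \<omega> then g \<omega> else 0) \<partial>M)"
    by (rule nn_integral_suminf[symmetric]) measurable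
  also have "\<dots> \<le> (\<integral>\<^sup>+\<omega>. g \<omega> \<partial>M)"
  proof (intro nn_integral_mono)
    fix \<omega>
    show "(\<Sum>j. if Q j \<omega> then g \<omega> else 0) \<le> g \<omega>"
    proof (cases "\<exists>j. Q j \<omega>")
      case True
      then obtain j where "Q j \<omega>" by blast
      then have "(\<Sum>j. if Q j \<omega> then g \<omega> else 0) = (\<Sum>j\<in>{j}. if Q j \<omega> then g \<omega> else 0)"
        using unique by (intro suminf_finite) auto
      then show ?thesis using \<open>Q j \<omega>\<close> by simp
    qed simp
  qed
  finally show ?thesis .
qed

text \<open>The set \<open>J\<close> is left free because the forward bound sums over an initial
  piece of the excursion and the backward bound over a final piece.\<close>

lemma sum_le_excursion_sum:
  assumes "\<eta> \<in> A" "finite J" "\<And>i j. j \<in> J \<Longrightarrow> 1 \<le> i \<Longrightarrow> i \<le> j \<Longrightarrow> \<theta> (real i) \<eta> \<notin> A"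
  shows "(\<Sum>j\<in>J. g (\<theta> (real j) \<eta>)) \<le> excursion_sum A g \<eta>"
proof -
  have "(\<Sum>j\<in>J. g (\<theta> (real j) \<eta>))
      = (\<Sum>j\<in>J. if \<eta> \<in> A \<and> (\<forall>i\<in>{1..j}. \<theta> (real i) \<eta> \<notin> A) then g (\<theta> (real j) \<eta>) else 0)"
    using assms by (intro sum.cong) auto
  also have "\<dots> \<le> excursion_sum A g \<eta>"
    unfolding excursion_sum_def using assms(2) by (intro sum_le_suminf) auto
  finally show ?thesis .
qed

text \<open>From the visit \<eta>, where \<open>f\<close> is at most \<open>C\<close>, each step
  adds at most one value of \<open>g\<close>, and all these values belong to the same
  excursion.\<close>

lemma excursion_bound_forward:
  fixes f :: "'w \<Rightarrow> ennreal"
  assumes step: "\<And>\<omega>. \<omega> \<in> space M \<Longrightarrow> f (\<theta> 1 \<omega>) \<le> f \<omega> + g \<omega>"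
    and \<eta>: "\<eta> \<in> space M" "\<eta> \<in> A" "f \<eta> \<le> C"
    and out: "\<And>i. 1 \<le> i \<Longrightarrow> i \<le> m \<Longrightarrow> \<theta> (real i) \<eta> \<notin> A"
  shows "f (\<theta> (real m) \<eta>) \<le> C + excursion_sum A g \<eta>"
proof -
  have "f (\<theta> (real n) \<eta>) \<le> C + (\<Sum>j<n. g (\<theta> (real j) \<eta>))" for n
  proof (induction n)
    case (Suc n)
    have "f (\<theta> (real (Suc n)) \<eta>) \<le> f (\<theta> (real n) \<eta>) + g (\<theta> (real n) \<eta>)"
      using step[of "\<theta> (real n) \<eta>"] \<eta> by (simp add: flow_add flow_space)
    also have "\<dots> \<le> C + (\<Sum>j<n. g (\<theta> (real j) \<eta>)) + g (\<theta> (real n) \<eta>)"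
      using Suc by (rule add_right_mono)
    finally show ?case by (simp add: add.assoc)
  qed (use \<eta> in \<open>simp add: flow_zero\<close>)
  also have "(\<Sum>j<m. g (\<theta> (real j) \<eta>)) \<le> excursion_sum A g \<eta>"
    using out \<eta> by (intro sum_le_excursion_sum) auto
  finally show ?thesis by simp
qed

text \<open>Here \<open>f\<close> is controlled from the future only, so the bound descends from the
  next return \<open>r\<close> to \<open>A\<close>, where \<open>f\<close> is again at most
  \<open>C\<close>. Without a return, \<open>1 \<le> g\<close> makes the excursion sum infinite and
  the bound trivial.\<close>

lemma excursion_bound_backward:
  fixes f :: "'w \<Rightarrow> ennreal"
  assumes step: "\<And>\<omega>. \<omega> \<in> space M \<Longrightarrow> f \<omega> \<le> f (\<theta> 1 \<omega>) + g \<omega>"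
    and g: "\<And>\<omega>. 1 \<le> g \<omega>"
    and \<eta>: "\<eta> \<in> space M" "\<eta> \<in> A"
    and A: "\<And>\<omega>. \<omega> \<in> A \<Longrightarrow> f \<omega> \<le> C"
    and out: "\<And>i. 1 \<le> i \<Longrightarrow> i \<le> m \<Longrightarrow> \<theta> (real i) \<eta> \<notin> A"
  shows "f (\<theta> (real m) \<eta>) \<le> C + excursion_sum A g \<eta>"
proof (cases "\<exists>r\<ge>1. \<theta> (real r) \<eta> \<in> A")
  case True
  define r where "r = (LEAST r. 1 \<le> r \<and> \<theta> (real r) \<eta> \<in> A)"
  have r: "1 \<le> r" "\<theta> (real r) \<eta> \<in> A"
    using LeastI_ex[OF True] by (auto simp: r_def)
  have before: "\<theta> (real i) \<eta> \<notin> A" if "1 \<le> i" "i < r" for i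
    using not_less_Least[of i] that by (auto simp: r_def)
  have "m < r" using out r by force
  have "f (\<theta> (real m) \<eta>) \<le> f (\<theta> (real (m + n)) \<eta>) + (\<Sum>j\<in>{m..<m+n}. g (\<theta> (real j) \<eta>))" for n
  proof (induction n)
    case (Suc n)
    have "f (\<theta> (real (m + n)) \<eta>) \<le> f (\<theta> (real (m + Suc n)) \<eta>) + g (\<theta> (real (m + n)) \<eta>)"
      using step[of "\<theta> (real (m + n)) \<eta>"] \<eta> by (simp add: flow_add flow_space add_ac)
    then have "f (\<theta> (real (m + n)) \<eta>) + (\<Sum>j\<in>{m..<m+n}. g (\<theta> (real j) \<eta>))
        \<le> f (\<theta> (real (m + Suc n)) \<eta>) + g (\<theta> (real (m + n)) \<eta>) + (\<Sum>j\<in>{m..<m+n}. g (\<theta> (real j) \<eta>))"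
      by (rule add_right_mono)
    with Suc have "f (\<theta> (real m) \<eta>)
        \<le> f (\<theta> (real (m + Suc n)) \<eta>) + g (\<theta> (real (m + n)) \<eta>) + (\<Sum>j\<in>{m..<m+n}. g (\<theta> (real j) \<eta>))"
      by (rule order_trans)
    then show ?case
      by (simp add: add.assoc add.commute[of "sum _ _"])
  qed simp
  from this[of "r - m"] have "f (\<theta> (real m) \<eta>) \<le> f (\<theta> (real r) \<eta>) + (\<Sum>j\<in>{m..<r}. g (\<theta> (real j) \<eta>))"
    using \<open>m < r\<close> by simp
  also have "\<dots> \<le> C + excursion_sum A g \<eta>"
    using r \<eta> before by (intro add_mono A sum_le_excursion_sum) auto
  finally show ?thesis .
next
  case False
  have "of_nat n \<le> excursion_sum A g \<eta>" for n
  proof -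
    have "of_nat n = (\<Sum>j<n. 1 :: ennreal)" by simp
    also have "\<dots> \<le> (\<Sum>j<n. g (\<theta> (real j) \<eta>))" by (intro sum_mono g)
    also have "\<dots> \<le> excursion_sum A g \<eta>"
      using False \<eta> by (intro sum_le_excursion_sum) auto
    finally show ?thesis .
  qed
  then have "excursion_sum A g \<eta> = top"
    using ennreal_Ex_less_of_nat[of "excursion_sum A g \<eta>"] by (metis less_top not_less)
  then show ?thesis by simp
qed

section \<open>From excursions to sublinear growth\<close>

text \<open>If \<open>C\<close> is at least \<open>f \<omega>\<close>, the orbit starts in
  \<open>A C\<close>, so there is a last visit \<open>k \<le> n\<close>. The excursion starting
  there bounds \<open>f\<close> at time \<open>n\<close>, and its sum, being integrable, is at most
  \<open>c + \<delta> * real k\<close>.\<close>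

lemma AE_orbit_sublinear_of_step:
  fixes f :: "'w \<Rightarrow> real" and g :: "'w \<Rightarrow> ennreal"
  assumes f[measurable]: "f \<in> borel_measurable M"
    and g[measurable]: "g \<in> borel_measurable M" and int: "(\<integral>\<^sup>+\<omega>. g \<omega> \<partial>M) < \<infinity>"
    and step: "(\<forall>\<omega>\<in>space M. ennreal (f (\<theta> 1 \<omega>)) \<le> ennreal (f \<omega>) + g \<omega>) \<or>
      (\<forall>\<omega>\<in>space M. ennreal (f \<omega>) \<le> ennreal (f (\<theta> 1 \<omega>)) + g \<omega>)"
    and "0 < \<delta>"
  shows "AE \<omega> in M. \<exists>c. \<forall>n::nat. f (\<theta> (real n) \<omega>) \<le> c + \<delta> * real n"
proof -
  \<comment> \<open>The added 1 makes the sum over an excursion without return infinite; it is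
    integrable on a probability space.\<close>
  define h where "h \<omega> = 1 + g \<omega>" for \<omega>
  define A where "A C = {\<omega> \<in> space M. f \<omega> \<le> real C}" for C
  have [measurable]: "h \<in> borel_measurable M" "A C \<in> sets M" for C
    unfolding h_def A_def by measurable
  have "(\<integral>\<^sup>+\<omega>. h \<omega> \<partial>M) < \<infinity>"
    using int by (simp add: h_def nn_integral_add emeasure_space_1)
  then have "(\<integral>\<^sup>+\<omega>. excursion_sum (A C) h \<omega> \<partial>M) < \<infinity>" for C
    using nn_integral_excursion_sum_le[of "A C" h] by (auto intro: le_less_trans)
  \<comment> \<open>\<open>C\<close> will depend on \<omega>, so one exceptional set has to serve
    all natural \<open>C\<close>.\<close>
  then have "AE \<omega> in M. \<forall>C::nat. \<exists>c::real. \<forall>k::nat. excursion_sum (A C) h (\<theta> (real k) \<omega>) \<le> ennreal (c + \<delta> * real k)"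
    using \<open>0 < \<delta>\<close> by (subst AE_all_countable) (auto intro!: AE_orbit_sublinear)
  moreover have "AE \<omega> in M. \<omega> \<in> space M" by simp
  ultimately show ?thesis
  proof eventually_elim
    case (elim \<omega>)
    obtain C where C: "f \<omega> \<le> real C" using real_arch_simple by blast
    obtain c where c: "\<And>k::nat. excursion_sum (A C) h (\<theta> (real k) \<omega>) \<le> ennreal (c + \<delta> * real k)"
      using elim by blast
    have "f (\<theta> (real n) \<omega>) \<le> (real C + max 0 c) + \<delta> * real n" for n
    proof -
      define k where "k = (GREATEST k. k \<le> n \<and> \<theta> (real k) \<omega> \<in> A C)"
      have start: "0 \<le> n \<and> \<theta> (real 0) \<omega> \<in> A C"
        using C elim by (simp add: A_def flow_zero)
      have k: "k \<le> n \<and> \<theta> (real k) \<omega> \<in> A C"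
        unfolding k_def by (rule GreatestI_nat[of _ 0 n]) (use start in auto)
      have last: "\<theta> (real i) \<omega> \<notin> A C" if "k < i" "i \<le> n" for i
        using Greatest_le_nat[of "\<lambda>k. k \<le> n \<and> \<theta> (real k) \<omega> \<in> A C" i n] that
        by (auto simp: k_def[symmetric])
      define \<eta> where "\<eta> = \<theta> (real k) \<omega>"
      have \<eta>: "\<eta> \<in> space M" "\<eta> \<in> A C" using k elim by (auto simp: \<eta>_def flow_space)
      have shift: "\<theta> (real i) \<eta> = \<theta> (real (i + k)) \<omega>" for i
        using elim by (simp add: \<eta>_def flow_add)
      have out: "\<theta> (real i) \<eta> \<notin> A C" if "1 \<le> i" "i \<le> n - k" for i
        unfolding shift using that by (intro last) auto
      have AC: "ennreal (f \<omega>) \<le> ennreal (real C)" if "\<omega> \<in> A C" for \<omega>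
        using that by (auto simp: A_def intro!: ennreal_leI)
      have "ennreal (f (\<theta> (real (n - k)) \<eta>)) \<le> ennreal (real C) + excursion_sum (A C) h \<eta>"
        using step
      proof
        assume *: "\<forall>\<omega>\<in>space M. ennreal (f (\<theta> 1 \<omega>)) \<le> ennreal (f \<omega>) + g \<omega>"
        show ?thesis
        proof (rule excursion_bound_forward[where f = "\<lambda>\<omega>. ennreal (f \<omega>)"])
          fix \<omega> assume "\<omega> \<in> space M"
          then have "ennreal (f (\<theta> 1 \<omega>)) \<le> ennreal (f \<omega>) + g \<omega>" using * by blast
          also have "\<dots> \<le> ennreal (f \<omega>) + h \<omega>" by (simp add: h_def add_left_mono add_increasing)
          finally show "ennreal (f (\<theta> 1 \<omega>)) \<le> ennreal (f \<omega>) + h \<omega>" .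
        qed (use \<eta> out AC in auto)
      next
        assume *: "\<forall>\<omega>\<in>space M. ennreal (f \<omega>) \<le> ennreal (f (\<theta> 1 \<omega>)) + g \<omega>"
        show ?thesis
        proof (rule excursion_bound_backward[where f = "\<lambda>\<omega>. ennreal (f \<omega>)"])
          fix \<omega> assume "\<omega> \<in> space M"
          then have "ennreal (f \<omega>) \<le> ennreal (f (\<theta> 1 \<omega>)) + g \<omega>" using * by blast
          also have "\<dots> \<le> ennreal (f (\<theta> 1 \<omega>)) + h \<omega>" by (simp add: h_def add_left_mono add_increasing)
          finally show "ennreal (f \<omega>) \<le> ennreal (f (\<theta> 1 \<omega>)) + h \<omega>" .
        qed (use \<eta> out AC in \<open>auto simp: h_def\<close>)
      qed
      also have "\<theta> (real (n - k)) \<eta> = \<theta> (real n) \<omega>"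
        unfolding shift using k by simp
      also have "ennreal (real C) + excursion_sum (A C) h \<eta> \<le> ennreal (real C) + ennreal (c + \<delta> * real k)"
        unfolding \<eta>_def by (intro add_left_mono c)
      also have "\<dots> \<le> ennreal (real C) + ennreal (max 0 c + \<delta> * real n)"
        using k \<open>0 < \<delta>\<close> by (intro add_left_mono ennreal_leI add_mono mult_left_mono) auto
      also have "\<dots> = ennreal (real C + (max 0 c + \<delta> * real n))"
        using \<open>0 < \<delta>\<close> by (intro ennreal_plus[symmetric]) auto
      finally show ?thesis
        using \<open>0 < \<delta>\<close> by (subst (asm) ennreal_le_iff) (auto simp: add_ac)
    qed
    then show ?case by blast
  qed
qed

text \<open>Unit steps give the bound at integer times, and steps of length \<open>s\<close> in the
  unit interval interpolate between them. The bound is available on the orbit from some shifted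
  point, and shifting the origin of time does not affect the limit.\<close>

lemma orbit_div_tendsto_0:
  fixes f :: "'w \<Rightarrow> real" and g :: "'w \<Rightarrow> ennreal"
  assumes f[measurable]: "f \<in> borel_measurable M" and nonneg: "\<And>\<omega>. \<omega> \<in> space M \<Longrightarrow> 0 \<le> f \<omega>"
    and g[measurable]: "g \<in> borel_measurable M" and int: "(\<integral>\<^sup>+\<omega>. g \<omega> \<partial>M) < \<infinity>"
    and step: "(\<forall>s\<in>{0..1}. \<forall>\<omega>\<in>space M. ennreal (f (\<theta> s \<omega>)) \<le> ennreal (f \<omega>) + g \<omega>) \<or>
      (\<forall>s\<in>{0..1}. \<forall>\<omega>\<in>space M. ennreal (f (\<theta> s \<omega>)) \<le> ennreal (f (\<theta> 1 \<omega>)) + g \<omega>)"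
  obtains A where "invariant_full_measure M \<theta> A"
    "\<And>\<omega>. \<omega> \<in> A \<Longrightarrow> ((\<lambda>t. f (\<theta> t \<omega>) / t) \<longlongrightarrow> 0) at_top"
proof -
  \<comment> \<open>The slopes \<open>1 / real (Suc m)\<close> reduce all positive slopes to
    countably many almost sure statements.\<close>
  define P where "P \<omega> \<longleftrightarrow> \<omega> \<in> space M \<and> (\<forall>m::nat. \<exists>c::real. \<forall>n::nat.
    f (\<theta> (real n) \<omega>) \<le> c + 1 / real (Suc m) * real n \<and>
    g (\<theta> (real n) \<omega>) \<le> ennreal (c + 1 / real (Suc m) * real n))" for \<omega>
  have "AE \<omega> in M. P \<omega>"
  proof -
    have step1: "(\<forall>\<omega>\<in>space M. ennreal (f (\<theta> 1 \<omega>)) \<le> ennreal (f \<omega>) + g \<omega>) \<or>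
        (\<forall>\<omega>\<in>space M. ennreal (f \<omega>) \<le> ennreal (f (\<theta> 1 \<omega>)) + g \<omega>)"
      using step
    proof
      assume *: "\<forall>s\<in>{0..1}. \<forall>\<omega>\<in>space M. ennreal (f (\<theta> s \<omega>)) \<le> ennreal (f (\<theta> 1 \<omega>)) + g \<omega>"
      \<comment> \<open>In this alternative the unit step is the case \<open>s = 0\<close>; in the
        other one it is \<open>s = 1\<close>.\<close>
      have "\<forall>\<omega>\<in>space M. ennreal (f \<omega>) \<le> ennreal (f (\<theta> 1 \<omega>)) + g \<omega>"
        using *[THEN bspec[of _ _ 0]] by (auto simp: flow_zero)
      then show ?thesis ..
    qed auto
    have "AE \<omega> in M. \<exists>c. \<forall>n::nat. f (\<theta> (real n) \<omega>) \<le> c + 1 / real (Suc m) * real n" for m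
      by (intro AE_orbit_sublinear_of_step[OF f g int step1]) simp
    then have 1: "AE \<omega> in M. \<forall>m. \<exists>c. \<forall>n::nat. f (\<theta> (real n) \<omega>) \<le> c + 1 / real (Suc m) * real n"
      by (simp add: AE_all_countable)
    have "AE \<omega> in M. \<exists>c. \<forall>n::nat. g (\<theta> (real n) \<omega>) \<le> ennreal (c + 1 / real (Suc m) * real n)" for m
      by (intro AE_orbit_sublinear[OF g int]) simp
    then have 2: "AE \<omega> in M. \<forall>m. \<exists>c. \<forall>n::nat. g (\<theta> (real n) \<omega>) \<le> ennreal (c + 1 / real (Suc m) * real n)"
      by (simp add: AE_all_countable)
    have "AE \<omega> in M. \<omega> \<in> space M" by simp
    with 1 2 show ?thesis
    proof eventually_elim
      case (elim \<omega>)
      have "\<exists>c. \<forall>n::nat. f (\<theta> (real n) \<omega>) \<le> c + 1 / real (Suc m) * real n \<and>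
          g (\<theta> (real n) \<omega>) \<le> ennreal (c + 1 / real (Suc m) * real n)" for m
      proof -
        obtain c1 where c1: "\<And>n. f (\<theta> (real n) \<omega>) \<le> c1 + 1 / real (Suc m) * real n"
          using elim(1) by blast
        obtain c2 where c2: "\<And>n. g (\<theta> (real n) \<omega>) \<le> ennreal (c2 + 1 / real (Suc m) * real n)"
          using elim(2) by blast
        have "f (\<theta> (real n) \<omega>) \<le> max c1 c2 + 1 / real (Suc m) * real n" for n
          using c1[of n] by linarith
        moreover have "g (\<theta> (real n) \<omega>) \<le> ennreal (max c1 c2 + 1 / real (Suc m) * real n)" for n
          by (rule order_trans[OF c2[of n]]) (intro ennreal_leI, simp)
        ultimately show ?thesis by blast
      qed
      with elim show ?case by (auto simp: P_def)
    qed
  qed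
  then obtain A where A: "invariant_full_measure M \<theta> A" "\<And>\<omega>. \<omega> \<in> A \<Longrightarrow> \<exists>t. P (\<theta> t \<omega>)"
    using AE_imp_invariant_full_measure by blast
  have "((\<lambda>t. f (\<theta> t \<omega>) / t) \<longlongrightarrow> 0) at_top" if "\<omega> \<in> A" for \<omega>
  proof -
    have \<omega>: "\<omega> \<in> space M"
      using A(1) that sets.sets_into_space by (auto simp: invariant_full_measure_def full_measure_def)
    obtain t0 where t0: "P (\<theta> t0 \<omega>)" using A(2) \<open>\<omega> \<in> A\<close> by blast
    define \<eta> where "\<eta> = \<theta> t0 \<omega>"
    have \<eta>: "\<eta> \<in> space M" using \<omega> by (simp add: \<eta>_def flow_space)
    show ?thesis
    proof (rule tendstoI)
      fix e :: real assume "0 < e"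
      \<comment> \<open>One third of \<open>e\<close> pays for the constants and two thirds for the
        slope \<open>2 * \<delta>\<close>, which arises since \<open>f\<close> and \<open>g\<close>
        contribute \<delta> each.\<close>
      obtain m where m: "1 / real (Suc m) < e / 3"
        using \<open>0 < e\<close> reals_Archimedean[of "e / 3"] by (auto simp: inverse_eq_divide)
      define \<delta> where "\<delta> = 1 / real (Suc m)"
      have "0 < \<delta>" by (simp add: \<delta>_def)
      obtain c where "\<And>n::nat. f (\<theta> (real n) \<eta>) \<le> c + \<delta> * real n"
        "\<And>n::nat. g (\<theta> (real n) \<eta>) \<le> ennreal (c + \<delta> * real n)"
        using t0 unfolding P_def \<eta>_def \<delta>_def by blast
      then have c: "ennreal (f (\<theta> (real n) \<eta>)) \<le> ennreal (c + \<delta> * real n)"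
        "g (\<theta> (real n) \<eta>) \<le> ennreal (c + \<delta> * real n)" "0 \<le> c" for n
        using nonneg[OF \<eta>] by (auto intro: ennreal_leI simp: flow_zero \<eta> dest: spec[of _ 0])
          (metis add.right_neutral flow_zero \<eta> mult_zero_right of_nat_0 order_trans)
      have bound: "f (\<theta> (t0 + t) \<omega>) \<le> 2 * c + \<delta> + 2 * \<delta> * t" if "0 \<le> t" for t
      proof -
        define n where "n = nat \<lfloor>t\<rfloor>"
        define s where "s = t - real n"
        have s: "s \<in> {0..1}" "real n \<le> t"
          using \<open>0 \<le> t\<close> real_of_int_floor_add_one_ge[of t] unfolding n_def s_def atLeastAtMost_iff
          by linarith+
        have eq: "\<theta> (t0 + t) \<omega> = \<theta> s (\<theta> (real n) \<eta>)"
          using \<omega> by (simp add: \<eta>_def flow_add s_def add_ac flow_space)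
        have sp: "\<theta> (real n) \<eta> \<in> space M" using \<eta> by (rule flow_space)
        have "ennreal (f (\<theta> (t0 + t) \<omega>)) \<le> ennreal (c + \<delta> * real (Suc n)) + ennreal (c + \<delta> * real n)"
          using step
        proof
          assume "\<forall>s\<in>{0..1}. \<forall>\<omega>\<in>space M. ennreal (f (\<theta> s \<omega>)) \<le> ennreal (f \<omega>) + g \<omega>"
          then have "ennreal (f (\<theta> (t0 + t) \<omega>)) \<le> ennreal (f (\<theta> (real n) \<eta>)) + g (\<theta> (real n) \<eta>)"
            using s sp unfolding eq by blast
          also have "\<dots> \<le> ennreal (c + \<delta> * real (Suc n)) + ennreal (c + \<delta> * real n)"
            using \<open>0 < \<delta>\<close>
            by (intro add_mono c order_trans[OF c(1)] ennreal_leI) auto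
          finally show ?thesis .
        next
          assume "\<forall>s\<in>{0..1}. \<forall>\<omega>\<in>space M. ennreal (f (\<theta> s \<omega>)) \<le> ennreal (f (\<theta> 1 \<omega>)) + g \<omega>"
          then have "ennreal (f (\<theta> (t0 + t) \<omega>)) \<le> ennreal (f (\<theta> 1 (\<theta> (real n) \<eta>))) + g (\<theta> (real n) \<eta>)"
            using s sp unfolding eq by blast
          also have "\<theta> 1 (\<theta> (real n) \<eta>) = \<theta> (real (Suc n)) \<eta>"
            using \<eta> by (simp add: flow_add)
          also have "ennreal (f (\<theta> (real (Suc n)) \<eta>)) + g (\<theta> (real n) \<eta>)
              \<le> ennreal (c + \<delta> * real (Suc n)) + ennreal (c + \<delta> * real n)"
            by (intro add_mono c)
          finally show ?thesis .
        qed
        also have "\<dots> = ennreal ((c + \<delta> * real (Suc n)) + (c + \<delta> * real n))"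
          using c(3) \<open>0 < \<delta>\<close> by (intro ennreal_plus[symmetric]) auto
        finally have "f (\<theta> (t0 + t) \<omega>) \<le> (c + \<delta> * real (Suc n)) + (c + \<delta> * real n)"
          using c(3) \<open>0 < \<delta>\<close> by (subst (asm) ennreal_le_iff) auto
        also have "\<dots> = 2 * c + \<delta> + 2 * \<delta> * real n" by (simp add: algebra_simps)
        also have "\<dots> \<le> 2 * c + \<delta> + 2 * \<delta> * t" using s \<open>0 < \<delta>\<close> by simp
        finally show ?thesis .
      qed
      \<comment> \<open>The absolute value covers both signs of the shift \<open>t0\<close>.\<close>
      define K where "K = 2 * c + \<delta> + 2 * \<delta> * \<bar>t0\<bar>"
      have "dist (f (\<theta> t \<omega>) / t) 0 < e" if t: "t > max 0 t0" "t > 3 * K / e" for t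
      proof -
        have "f (\<theta> t \<omega>) \<le> 2 * c + \<delta> + 2 * \<delta> * (t - t0)"
          using bound[of "t - t0"] t by simp
        also have "\<dots> = 2 * c + \<delta> + 2 * \<delta> * (- t0) + 2 * \<delta> * t" by (simp add: algebra_simps)
        also have "\<dots> \<le> K + 2 * \<delta> * t"
          unfolding K_def using \<open>0 < \<delta>\<close> by (intro add_mono mult_left_mono) auto
        also have "\<dots> < e / 3 * t + 2 * (e / 3) * t"
        proof (rule add_strict_mono)
          show "K < e / 3 * t" using t \<open>0 < e\<close> by (simp add: field_simps)
          have "\<delta> * t < e / 3 * t"
            using m t unfolding \<delta>_def by (intro mult_strict_right_mono) auto
          then show "2 * \<delta> * t < 2 * (e / 3) * t" by simp
        qed
        finally have "f (\<theta> t \<omega>) < e * t" by simp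
        then show ?thesis
          using t nonneg[of "\<theta> t \<omega>"] \<omega> by (simp add: flow_space field_simps)
      qed
      then show "\<forall>\<^sub>F t in at_top. dist (f (\<theta> t \<omega>) / t) 0 < e"
        by (intro eventually_mono[OF eventually_conj[OF eventually_gt_at_top[of "max 0 t0"]
          eventually_gt_at_top[of "3 * K / e"]]]) auto
    qed
  qed
  with A(1) that show ?thesis by blast
qed

end

section \<open>Optimal growth constants\<close>

lemma closure_nonneg_Rats: "{0..} \<subseteq> closure ({0..} \<inter> \<rat> :: real set)"
proof
  fix t :: real assume "t \<in> {0..}"
  have "\<exists>q\<in>{0..} \<inter> \<rat>. dist q t < e" if "e > 0" for e
  proof -
    have "t < t + e" using that by simp
    from Rats_dense_in_real[OF this] obtain q where "q \<in> \<rat>" "t < q" "q < t + e" by blast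
    then show ?thesis
      using \<open>t \<in> {0..}\<close> by (intro bexI[of _ q]) (auto simp: dist_real_def)
  qed
  then show "t \<in> closure ({0..} \<inter> \<rat>)"
    by (simp add: closure_approachable)
qed

lemma le_on_nonneg_if_le_on_Rats:
  fixes \<phi> :: "real \<Rightarrow> real"
  assumes "continuous_on {0..} \<phi>" "\<And>q. 0 \<le> q \<Longrightarrow> q \<in> \<rat> \<Longrightarrow> \<phi> q \<le> a" "0 \<le> t"
  shows "\<phi> t \<le> a"
proof (rule continuous_le_on_closure[where S = "{0..} \<inter> \<rat>" and f = \<phi> and x = t])
  have "closure ({0..} \<inter> \<rat>) \<subseteq> {0::real..}"
    by (intro closure_minimal) auto
  then show "continuous_on (closure ({0..} \<inter> \<rat>)) \<phi>"
    using assms(1) continuous_on_subset by blast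
  show "t \<in> closure ({0..} \<inter> \<rat>)"
    using closure_nonneg_Rats \<open>0 \<le> t\<close> by auto
qed (use assms in auto)

lemma nonneg_Rats_ne: "{0..} \<inter> \<rat> \<noteq> ({} :: real set)"
  by (rule ex_in_conv[THEN iffD1]) (intro exI[of _ 0], simp)

lemma countable_nonneg_Rats: "countable ({0..} \<inter> \<rat> :: real set)"
  by (simp add: countable_rat countable_Int2)

text \<open>Restricting the time to the rationals makes these quantities measurable in the
  random parameter.\<close>

definition growth_sup :: "(real \<Rightarrow> 'a::real_normed_vector \<Rightarrow>\<^sub>L 'b::real_normed_vector) \<Rightarrow> 'a set \<Rightarrow> real \<Rightarrow> real" where
  "growth_sup W E \<mu> = max 1 (SUP q\<in>{0..} \<inter> \<rat>. norm_on (W q) E * exp (- \<mu> * q))"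

definition growth_inf :: "(real \<Rightarrow> 'a::real_normed_vector \<Rightarrow>\<^sub>L 'b::real_normed_vector) \<Rightarrow> 'a set \<Rightarrow> real \<Rightarrow> real" where
  "growth_inf W E r = (INF q\<in>{0..} \<inter> \<rat>. norm_on (W q) E * exp (- r * q))"

lemma mult_exp_minus_le_iff:
  "a * exp (- r * t) \<le> c \<longleftrightarrow> a \<le> c * exp (r * t :: real)"
  by (simp add: exp_minus field_simps)

lemma le_mult_exp_minus_iff:
  "c \<le> a * exp (- r * t) \<longleftrightarrow> c * exp (r * t :: real) \<le> a"
  by (simp add: exp_minus field_simps)

text \<open>The cut-off at 1 keeps the logarithm nonnegative, and the constant positive even for
  \<open>E = {0}\<close>.\<close>

lemma growth_sup_ge_1: "1 \<le> growth_sup W E \<mu>"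
  by (simp add: growth_sup_def)

lemma growth_sup_bdd_above:
  assumes "\<And>t. 0 \<le> t \<Longrightarrow> norm_on (W t) E \<le> c * exp (\<mu> * t)"
  shows "bdd_above ((\<lambda>q. norm_on (W q) E * exp (- \<mu> * q)) ` ({0..} \<inter> \<rat>))"
  using assms by (intro bdd_aboveI2[of _ _ c]) (auto simp: mult_exp_minus_le_iff[of _ \<mu>, simplified])

text \<open>The norm on \<open>E\<close> is not assumed continuous in time, so the passage from
  rational to real times is made for each vector separately, by strong continuity. The bound
  \<open>bd\<close> makes the supremum a genuine one.\<close>

lemma norm_on_le_growth_sup:
  assumes ne: "E \<noteq> {}" and cont: "\<And>x. continuous_on {0..} (\<lambda>t. blinfun_apply (W t) x)"
    and bd: "\<And>t. 0 \<le> t \<Longrightarrow> norm_on (W t) E \<le> c * exp (\<mu> * t)" and "0 \<le> t"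
  shows "norm_on (W t) E \<le> growth_sup W E \<mu> * exp (\<mu> * t)"
proof (rule norm_on_le[OF ne])
  show "0 \<le> growth_sup W E \<mu> * exp (\<mu> * t)"
    using growth_sup_ge_1[of W E \<mu>] by simp
  fix x assume x: "x \<in> E"
  have "norm (W t x) * exp (- \<mu> * t) \<le> growth_sup W E \<mu> * norm x"
  proof (rule le_on_nonneg_if_le_on_Rats[OF _ _ \<open>0 \<le> t\<close>])
    show "continuous_on {0..} (\<lambda>t. norm (W t x) * exp (- \<mu> * t))"
      by (intro continuous_intros cont)
    fix q :: real assume q: "0 \<le> q" "q \<in> \<rat>"
    have "norm_on (W q) E * exp (- \<mu> * q) \<le> growth_sup W E \<mu>"
      unfolding growth_sup_def using q
      by (intro max.coboundedI2 cSUP_upper growth_sup_bdd_above[OF bd]) auto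
    then have "norm_on (W q) E * exp (- \<mu> * q) * norm x \<le> growth_sup W E \<mu> * norm x"
      by (rule mult_right_mono) simp
    moreover have "norm (W q x) * exp (- \<mu> * q) \<le> norm_on (W q) E * norm x * exp (- \<mu> * q)"
      using x by (intro mult_right_mono norm_on_apply) auto
    moreover have "norm_on (W q) E * norm x * exp (- \<mu> * q) = norm_on (W q) E * exp (- \<mu> * q) * norm x"
      by (simp only: mult_ac)
    ultimately show "norm (W q x) * exp (- \<mu> * q) \<le> growth_sup W E \<mu> * norm x"
      by linarith
  qed
  then show "norm (W t x) \<le> growth_sup W E \<mu> * exp (\<mu> * t) * norm x"
    by (simp add: mult_exp_minus_le_iff[of _ \<mu>, simplified] mult_ac)
qed

lemma growth_sup_least:
  assumes "1 \<le> c" "\<And>t. 0 \<le> t \<Longrightarrow> norm_on (W t) E \<le> c * exp (\<mu> * t)"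
  shows "growth_sup W E \<mu> \<le> c"
  unfolding growth_sup_def using assms nonneg_Rats_ne
  by (intro max.boundedI cSUP_least) (auto simp: mult_exp_minus_le_iff[of _ \<mu>, simplified])

lemma growth_inf_greatest:
  assumes "\<And>t. 0 \<le> t \<Longrightarrow> c * exp (r * t) \<le> norm_on (W t) E"
  shows "c \<le> growth_inf W E r"
  unfolding growth_inf_def using assms nonneg_Rats_ne
  by (intro cINF_greatest) (auto simp: le_mult_exp_minus_iff[of _ _ r, simplified])

text \<open>A lower bound on the norm cannot be checked vector by vector. Finite dimension helps
  instead: the norm of \<open>W q\<close> on \<open>E\<close> exceeds that of \<open>W t\<close> by
  at most a finite sum of errors at fixed vectors, which is continuous in \<open>q\<close>.\<close>

lemma growth_inf_le_norm_on:
  fixes E :: "'a::real_inner set" and W :: "real \<Rightarrow> 'a \<Rightarrow>\<^sub>L 'b::real_normed_vector"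
  assumes dim: "has_dimension E d" and ne: "E \<noteq> {}"
    and cont: "\<And>x. continuous_on {0..} (\<lambda>t. blinfun_apply (W t) x)" and "0 \<le> t"
  shows "growth_inf W E r * exp (r * t) \<le> norm_on (W t) E"
proof -
  obtain C where C: "finite C"
    "\<And>T :: 'a \<Rightarrow>\<^sub>L 'b. norm_on T E \<le> (\<Sum>c\<in>C. norm (T c) / norm c)"
    using norm_on_le_sum[OF dim] by metis
  have bdd: "bdd_below ((\<lambda>q. norm_on (W q) E * exp (- r * q)) ` ({0..} \<inter> \<rat>))"
    by (intro bdd_belowI2[of _ 0] mult_nonneg_nonneg norm_on_nonneg ne) simp
  \<comment> \<open>The error term vanishes at \<open>s = t\<close>, so the value of \<phi> there is
    the claimed lower bound.\<close>
  define \<phi> where "\<phi> s = growth_inf W E r * exp (r * s) - (\<Sum>c\<in>C. norm ((W s - W t) c) / norm c)" for s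
  have "\<phi> t \<le> norm_on (W t) E"
  proof (rule le_on_nonneg_if_le_on_Rats[OF _ _ \<open>0 \<le> t\<close>])
    show "continuous_on {0..} \<phi>"
      unfolding \<phi>_def blinfun.diff_left divide_inverse by (intro continuous_intros cont)
    fix q :: real assume q: "0 \<le> q" "q \<in> \<rat>"
    have "growth_inf W E r \<le> norm_on (W q) E * exp (- r * q)"
      unfolding growth_inf_def using q by (intro cINF_lower bdd) auto
    then have "growth_inf W E r * exp (r * q) \<le> norm_on (W q) E"
      by (simp add: le_mult_exp_minus_iff[of _ _ r, simplified])
    also have "\<dots> \<le> norm_on (W t) E + norm_on (W q - W t) E"
      by (rule norm_on_le_add[OF ne])
    also have "\<dots> \<le> norm_on (W t) E + (\<Sum>c\<in>C. norm ((W q - W t) c) / norm c)"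
      using C(2) by (rule add_left_mono)
    finally show "\<phi> q \<le> norm_on (W t) E" by (simp add: \<phi>_def)
  qed
  then show ?thesis by (simp add: \<phi>_def)
qed

section \<open>Finiteness, positivity and measurability of the constants\<close>

lemma bounded_if_eventually_bounded:
  fixes \<phi> :: "real \<Rightarrow> real"
  assumes "continuous_on {0..} \<phi>" "\<And>t. 0 \<le> t \<Longrightarrow> \<tau> \<le> t \<Longrightarrow> \<phi> t \<le> b"
  shows "\<exists>c. \<forall>t\<ge>0. \<phi> t \<le> c"
proof -
  have "compact (\<phi> ` {0..\<tau>})"
    using assms(1) by (intro compact_continuous_image) (auto intro: continuous_on_subset)
  then obtain c where c: "\<And>t. t \<in> {0..\<tau>} \<Longrightarrow> \<bar>\<phi> t\<bar> \<le> c"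
    using compact_imp_bounded bounded_iff by (metis imageI real_norm_def)
  have "\<phi> t \<le> max b c" if "0 \<le> t" for t
    using assms(2)[of t] c[of t] that by (cases "\<tau> \<le> t") auto
  then show ?thesis by blast
qed

text \<open>The time from which the growth bound holds depends on the vector, so uniformity has to
  come from the uniform boundedness principle. Composing with the projection \<open>P\<close> gives
  operators on the whole complete space and changes nothing on \<open>E\<close>.\<close>

lemma growth_bound_if_pointwise:
  fixes W :: "real \<Rightarrow> 'a::{real_normed_vector, complete_space} \<Rightarrow>\<^sub>L 'b::real_normed_vector"
  assumes cont: "\<And>x. continuous_on {0..} (\<lambda>t. blinfun_apply (W t) x)"
    and P: "\<And>x. blinfun_apply P x \<in> E" "\<And>x. x \<in> E \<Longrightarrow> P x = x"
    and growth: "\<And>x. x \<in> E \<Longrightarrow> \<exists>\<tau>. \<forall>t\<ge>0. \<tau> \<le> t \<longrightarrow> norm (W t x) \<le> norm x * exp (\<mu> * t)"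
  shows "\<exists>c. \<forall>t\<ge>0. norm_on (W t) E \<le> c * exp (\<mu> * t)"
proof -
  define T where "T t = exp (- \<mu> * t) *\<^sub>R (W t o\<^sub>L P)" for t
  have "\<exists>c. \<forall>t\<in>{0..}. norm (T t x) \<le> c" for x
  proof -
    obtain \<tau> where \<tau>: "\<And>t. 0 \<le> t \<Longrightarrow> \<tau> \<le> t \<Longrightarrow> norm (W t (P x)) \<le> norm (P x) * exp (\<mu> * t)"
      using growth P by blast
    have "\<exists>c. \<forall>t\<ge>0. norm (W t (P x)) * exp (- \<mu> * t) \<le> c"
      using \<tau> by (intro bounded_if_eventually_bounded[of _ \<tau> "norm (P x)"] continuous_intros cont)
        (auto simp: mult_exp_minus_le_iff[of _ \<mu>, simplified])
    then show ?thesis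
      by (auto simp: T_def blinfun.scaleR_left mult.commute)
  qed
  then obtain c where c: "\<And>t. 0 \<le> t \<Longrightarrow> norm (T t) \<le> c"
    using uniform_boundedness[of "{0..}" T] by auto
  have "0 \<le> c" using c[of 0] norm_ge_zero order_trans by blast
  have "norm_on (W t) E \<le> c * exp (\<mu> * t)" if "0 \<le> t" for t
  proof (rule norm_on_le)
    show "E \<noteq> {}" using P by blast
    fix x assume "x \<in> E"
    then have "norm (W t x) * exp (- \<mu> * t) = norm (T t x)"
      by (simp add: T_def blinfun.scaleR_left P)
    also have "\<dots> \<le> norm (T t) * norm x" by (rule norm_blinfun)
    also have "\<dots> \<le> c * norm x" using c that by (simp add: mult_right_mono)
    finally show "norm (W t x) \<le> c * exp (\<mu> * t) * norm x"
      by (simp add: mult_exp_minus_le_iff[of _ \<mu>, simplified] mult_ac)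
  qed (use \<open>0 \<le> c\<close> in auto)
  then show ?thesis by blast
qed

text \<open>A single growing vector of \<open>E\<close> bounds the norm from below at late times; on
  the initial interval compactness and \<open>nz\<close> supply a positive constant.\<close>

lemma growth_inf_pos:
  assumes cont: "\<And>x. continuous_on {0..} (\<lambda>t. blinfun_apply (W t) x)"
    and x: "x \<in> E" "x \<noteq> 0" and nz: "\<And>t. 0 \<le> t \<Longrightarrow> blinfun_apply (W t) x \<noteq> 0"
    and growth: "\<And>t. 0 \<le> t \<Longrightarrow> \<tau> \<le> t \<Longrightarrow> norm x * exp (r * t) \<le> norm (W t x)"
  shows "0 < growth_inf W E r"
proof -
  \<comment> \<open>An upper bound on this reciprocal is a positive lower bound on
    \<open>norm (W t x)\<close> relative to \<open>exp (r * t)\<close>.\<close>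
  have "\<exists>c. \<forall>t\<ge>0. inverse (norm (W t x)) * exp (r * t) \<le> c"
  proof (rule bounded_if_eventually_bounded)
    show "continuous_on {0..} (\<lambda>t. inverse (norm (W t x)) * exp (r * t))"
      using nz by (intro continuous_intros cont) auto
    show "inverse (norm (W t x)) * exp (r * t) \<le> inverse (norm x)" if "0 \<le> t" "\<tau> \<le> t" for t
      using growth[OF that] x nz[of t] that by (simp add: field_simps)
  qed
  then obtain c where c: "\<And>t. 0 \<le> t \<Longrightarrow> inverse (norm (W t x)) * exp (r * t) \<le> c"
    by blast
  have "0 < inverse (norm (W 0 x)) * exp (r * 0)" using nz[of 0] by simp
  also have "\<dots> \<le> c" using c[of 0] by simp
  finally have "0 < c" .
  have "inverse (c * norm x) * exp (r * t) \<le> norm_on (W t) E" if "0 \<le> t" for t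
  proof -
    have "exp (r * t) \<le> c * norm (W t x)"
      using c[OF that] nz[OF that] by (simp add: field_simps)
    also have "\<dots> \<le> c * (norm_on (W t) E * norm x)"
      using \<open>0 < c\<close> x by (intro mult_left_mono norm_on_apply) auto
    finally show ?thesis
      using \<open>0 < c\<close> x by (simp add: field_simps)
  qed
  then have "inverse (c * norm x) \<le> growth_inf W E r"
    by (rule growth_inf_greatest)
  moreover have "0 < inverse (c * norm x)" using \<open>0 < c\<close> x by simp
  ultimately show ?thesis by linarith
qed

text \<open>The subspace varies with \<omega>. As the range of \<open>P \<omega>\<close> it is
  parametrized by the fixed space, and by continuity a countable dense set of parameters decides
  whether the norm is at most \<open>c\<close>.\<close>

lemma borel_measurable_norm_on:
  fixes T :: "'w \<Rightarrow> 'a::{real_normed_vector, second_countable_topology} \<Rightarrow>\<^sub>L 'b::{real_normed_vector, second_countable_topology}"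
    and P :: "'w \<Rightarrow> 'a \<Rightarrow>\<^sub>L 'a"
  assumes P: "\<And>x. (\<lambda>\<omega>. P \<omega> x) \<in> borel_measurable N" "\<And>\<omega>. \<omega> \<in> space N \<Longrightarrow> range (P \<omega>) = E \<omega>"
    and T: "\<And>x. (\<lambda>\<omega>. T \<omega> (P \<omega> x)) \<in> borel_measurable N"
  shows "(\<lambda>\<omega>. norm_on (T \<omega>) (E \<omega>)) \<in> borel_measurable N"
proof (rule borel_measurable_iff_le[THEN iffD2, rule_format])
  fix c :: real
  note [measurable] = P(1) T
  have ne: "E \<omega> \<noteq> {}" if "\<omega> \<in> space N" for \<omega> using P(2)[OF that] by auto
  show "{\<omega> \<in> space N. norm_on (T \<omega>) (E \<omega>) \<le> c} \<in> sets N"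
  proof (cases "0 \<le> c")
    case True
    obtain D :: "'a set" where D: "countable D" "\<And>X. open X \<Longrightarrow> X \<noteq> {} \<Longrightarrow> \<exists>d\<in>D. d \<in> X"
      using countable_dense_setE by blast
    have dense: "x \<in> closure D" for x
      using D(2)[of "ball x e" for e] by (fastforce simp: closure_approachable dist_commute)
    have "norm_on (T \<omega>) (E \<omega>) \<le> c \<longleftrightarrow> (\<forall>x\<in>D. norm (T \<omega> (P \<omega> x)) \<le> c * norm (P \<omega> x))"
      if \<omega>: "\<omega> \<in> space N" for \<omega>
    proof -
      have "norm (T \<omega> (P \<omega> x)) - c * norm (P \<omega> x) \<le> 0"
        if "\<forall>x\<in>D. norm (T \<omega> (P \<omega> x)) \<le> c * norm (P \<omega> x)" for x
        by (rule continuous_le_on_closure[OF _ dense]) (use that in \<open>auto intro!: continuous_intros\<close>)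
      then show ?thesis
        unfolding norm_on_le_iff[OF ne[OF \<omega>] True] unfolding P(2)[OF \<omega>, symmetric] by auto
    qed
    then have "{\<omega> \<in> space N. norm_on (T \<omega>) (E \<omega>) \<le> c}
        = {\<omega> \<in> space N. \<forall>x\<in>D. norm (T \<omega> (P \<omega> x)) \<le> c * norm (P \<omega> x)}"
      by auto
    also have "\<dots> \<in> sets N"
      using D(1) by measurable
    finally show ?thesis .
  next
    case False
    have "{\<omega> \<in> space N. norm_on (T \<omega>) (E \<omega>) \<le> c} = {}"
      using False order_trans[OF norm_on_nonneg[OF ne]] by blast
    then show ?thesis by (simp only: sets.empty_sets)
  qed
qed

section \<open>Temperedness of the growth constants\<close>

context metric_dynamical_system
begin

lemma invariant_full_measureD:
  assumes "invariant_full_measure M \<theta> \<Omega>\<^sub>0"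
  shows "\<Omega>\<^sub>0 \<in> sets M" "\<Omega>\<^sub>0 \<subseteq> space M" "emeasure M \<Omega>\<^sub>0 = 1"
  using assms sets.sets_into_space by (auto simp: invariant_full_measure_def full_measure_def)

lemma flow_mem_invariant_iff:
  assumes "invariant_full_measure M \<theta> \<Omega>\<^sub>0" "\<omega> \<in> space M"
  shows "\<theta> s \<omega> \<in> \<Omega>\<^sub>0 \<longleftrightarrow> \<omega> \<in> \<Omega>\<^sub>0"
proof -
  have img: "\<theta> t \<eta> \<in> \<Omega>\<^sub>0" if "\<eta> \<in> \<Omega>\<^sub>0" for t \<eta>
    using assms(1) that by (auto simp: invariant_full_measure_def)
  have "\<theta> (- s) (\<theta> s \<omega>) = \<omega>"
    using assms(2) by (simp add: flow_add flow_zero)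
  then show ?thesis using img by metis
qed

lemma invariant_full_measure_Int:
  assumes A: "invariant_full_measure M \<theta> A" and B: "invariant_full_measure M \<theta> B"
  shows "invariant_full_measure M \<theta> (A \<inter> B)"
proof -
  note AM = invariant_full_measureD[OF A] and BM = invariant_full_measureD[OF B]
  have "\<theta> t ` (A \<inter> B) = A \<inter> B" for t
  proof
    show "A \<inter> B \<subseteq> \<theta> t ` (A \<inter> B)"
    proof
      fix \<omega> assume \<omega>: "\<omega> \<in> A \<inter> B"
      then have "\<omega> \<in> space M" using AM by auto
      then have "\<omega> = \<theta> t (\<theta> (- t) \<omega>)" "\<theta> (- t) \<omega> \<in> A \<inter> B"
        using \<omega> flow_mem_invariant_iff[OF A] flow_mem_invariant_iff[OF B]
        by (auto simp: flow_add flow_zero)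
      then show "\<omega> \<in> \<theta> t ` (A \<inter> B)" by blast
    qed
  next
    show "\<theta> t ` (A \<inter> B) \<subseteq> A \<inter> B"
      using AM flow_mem_invariant_iff[OF A] flow_mem_invariant_iff[OF B] by auto
  qed
  moreover have "AE \<omega> in M. \<omega> \<in> A" "AE \<omega> in M. \<omega> \<in> B"
    using AM BM emeasure_eq_1_AE prob_eq_1 by (auto simp: emeasure_eq_measure)
  then have "AE \<omega> in M. \<omega> \<in> A \<inter> B" by auto
  then have "emeasure M (A \<inter> B) = 1"
    using AM BM by (intro emeasure_eq_1_AE) auto
  ultimately show ?thesis
    using AM BM by (auto simp: invariant_full_measure_def full_measure_def)
qed

text \<open>Invariance of \<open>\<Omega>\<^sub>0\<close> allows \<open>ln X\<close> to be extended
  by 0 to the whole space without spoiling the step inequality. On \<open>\<Omega>\<^sub>0\<close>,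
  \<open>1 \<le> X\<close> makes the positive part of the logarithm the logarithm itself.\<close>

lemma tempered_restrict_spaceI:
  fixes X :: "'w \<Rightarrow> real" and g :: "'w \<Rightarrow> ennreal"
  assumes inv: "invariant_full_measure M \<theta> \<Omega>\<^sub>0"
    and X: "X \<in> borel_measurable (restrict_space M \<Omega>\<^sub>0)" "\<And>\<omega>. \<omega> \<in> \<Omega>\<^sub>0 \<Longrightarrow> 1 \<le> X \<omega>"
    and g: "g \<in> borel_measurable M" and int: "(\<integral>\<^sup>+\<omega>. g \<omega> \<partial>M) < \<infinity>"
    and step: "(\<forall>s\<in>{0..1}. \<forall>\<omega>\<in>\<Omega>\<^sub>0. ennreal (ln (X (\<theta> s \<omega>))) \<le> ennreal (ln (X \<omega>)) + g \<omega>) \<or>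
      (\<forall>s\<in>{0..1}. \<forall>\<omega>\<in>\<Omega>\<^sub>0. ennreal (ln (X (\<theta> s \<omega>))) \<le> ennreal (ln (X (\<theta> 1 \<omega>))) + g \<omega>)"
  shows "tempered (restrict_space M \<Omega>\<^sub>0) \<theta> X"
proof -
  note \<Omega>\<^sub>0 = invariant_full_measureD[OF inv]
  have sp: "space (restrict_space M \<Omega>\<^sub>0) = \<Omega>\<^sub>0"
    using \<Omega>\<^sub>0 by (auto simp: space_restrict_space)
  define f where "f \<omega> = indicator \<Omega>\<^sub>0 \<omega> *\<^sub>R ln (X \<omega>)" for \<omega>
  have f: "f \<in> borel_measurable M"
    unfolding f_def using \<Omega>\<^sub>0 X(1) by (subst borel_measurable_restrict_space_iff[symmetric]) auto
  have f_in: "f \<omega> = ln (X \<omega>)" if "\<omega> \<in> \<Omega>\<^sub>0" for \<omega> using that by (simp add: f_def)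
  have f_out: "f \<omega> = 0" if "\<omega> \<notin> \<Omega>\<^sub>0" for \<omega> using that by (simp add: f_def)
  have nonneg: "0 \<le> f \<omega>" for \<omega> using X(2) by (cases "\<omega> \<in> \<Omega>\<^sub>0") (auto simp: f_in f_out)
  note mem = flow_mem_invariant_iff[OF inv]
  have "(\<forall>s\<in>{0..1}. \<forall>\<omega>\<in>space M. ennreal (f (\<theta> s \<omega>)) \<le> ennreal (f \<omega>) + g \<omega>) \<or>
      (\<forall>s\<in>{0..1}. \<forall>\<omega>\<in>space M. ennreal (f (\<theta> s \<omega>)) \<le> ennreal (f (\<theta> 1 \<omega>)) + g \<omega>)"
    using step
  proof (elim disj_forward ballI)
    assume *: "\<forall>s\<in>{0..1}. \<forall>\<omega>\<in>\<Omega>\<^sub>0. ennreal (ln (X (\<theta> s \<omega>))) \<le> ennreal (ln (X \<omega>)) + g \<omega>"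
    show "\<forall>s\<in>{0..1}. \<forall>\<omega>\<in>space M. ennreal (f (\<theta> s \<omega>)) \<le> ennreal (f \<omega>) + g \<omega>"
    proof (intro ballI)
      fix s :: real and \<omega> assume "s \<in> {0..1}" "\<omega> \<in> space M"
      then show "ennreal (f (\<theta> s \<omega>)) \<le> ennreal (f \<omega>) + g \<omega>"
        using * by (cases "\<omega> \<in> \<Omega>\<^sub>0") (auto simp: f_in f_out mem)
    qed
  next
    assume *: "\<forall>s\<in>{0..1}. \<forall>\<omega>\<in>\<Omega>\<^sub>0. ennreal (ln (X (\<theta> s \<omega>))) \<le> ennreal (ln (X (\<theta> 1 \<omega>))) + g \<omega>"
    show "\<forall>s\<in>{0..1}. \<forall>\<omega>\<in>space M. ennreal (f (\<theta> s \<omega>)) \<le> ennreal (f (\<theta> 1 \<omega>)) + g \<omega>"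
    proof (intro ballI)
      fix s :: real and \<omega> assume "s \<in> {0..1}" "\<omega> \<in> space M"
      then show "ennreal (f (\<theta> s \<omega>)) \<le> ennreal (f (\<theta> 1 \<omega>)) + g \<omega>"
        using * by (cases "\<omega> \<in> \<Omega>\<^sub>0") (auto simp: f_in f_out mem)
    qed
  qed
  then obtain A where A: "invariant_full_measure M \<theta> A"
    "\<And>\<omega>. \<omega> \<in> A \<Longrightarrow> ((\<lambda>t. f (\<theta> t \<omega>) / t) \<longlongrightarrow> 0) at_top"
    using orbit_div_tendsto_0[OF f nonneg g int] by blast
  have "invariant_full_measure M \<theta> (A \<inter> \<Omega>\<^sub>0)"
    by (rule invariant_full_measure_Int[OF A(1) inv])
  then have "invariant_full_measure (restrict_space M \<Omega>\<^sub>0) \<theta> (A \<inter> \<Omega>\<^sub>0)"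
    using \<Omega>\<^sub>0 by (auto simp: invariant_full_measure_def full_measure_def
        sets_restrict_space_iff emeasure_restrict_space)
  moreover have "((\<lambda>t. max 0 (ln (X (\<theta> t \<omega>))) / t) \<longlongrightarrow> 0) at_top" if "\<omega> \<in> A \<inter> \<Omega>\<^sub>0" for \<omega>
  proof -
    have "max 0 (ln (X (\<theta> t \<omega>))) = f (\<theta> t \<omega>)" for t
      using that \<Omega>\<^sub>0 mem[of \<omega> t] nonneg[of "\<theta> t \<omega>"] by (auto simp: f_in)
    then show ?thesis using A(2) that by auto
  qed
  ultimately show ?thesis
    unfolding tempered_def sp using X by (meson less_le_trans zero_less_one)
qed

end

section \<open>Comparison of the constants along the flow\<close>

lemma norm_le_exp_log_plus_sup:
  assumes fin: "log_plus_sup \<theta> U \<omega> \<noteq> \<infinity>" and t: "t\<^sub>1 \<in> {0..1}" "t\<^sub>2 \<in> {0..1}"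
  shows "norm (U t\<^sub>1 (\<theta> t\<^sub>2 \<omega>)) \<le> exp (enn2real (log_plus_sup \<theta> U \<omega>))"
proof -
  define r where "r = (SUP (t\<^sub>1, t\<^sub>2) \<in> {0..1} \<times> {0..1}. ennreal (norm (U t\<^sub>1 (\<theta> t\<^sub>2 \<omega>))))"
  have D: "log_plus_sup \<theta> U \<omega> = ennreal_log_plus r"
    by (simp add: log_plus_sup_def r_def)
  then have "r \<noteq> \<infinity>" using fin by (auto simp: ennreal_log_plus_def)
  then obtain q where q: "r = ennreal q" "0 \<le> q" by (cases r) auto
  have "ennreal (norm (U t\<^sub>1 (\<theta> t\<^sub>2 \<omega>))) \<le> r"
    unfolding r_def using t by (intro SUP_upper2[of "(t\<^sub>1, t\<^sub>2)"]) auto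
  then have "norm (U t\<^sub>1 (\<theta> t\<^sub>2 \<omega>)) \<le> q" using q by simp
  \<comment> \<open>The positive part covers \<open>q < 1\<close>; \<open>q = 0\<close> is treated
    apart because its logarithm is a default value.\<close>
  also have "q \<le> exp (max 0 (ln q))"
  proof (cases "q = 0")
    case False
    then have "q = exp (ln q)" using q by simp
    also have "\<dots> \<le> exp (max 0 (ln q))" by simp
    finally show ?thesis .
  qed simp
  also have "max 0 (ln q) = enn2real (log_plus_sup \<theta> U \<omega>)"
    unfolding D q(1) using q(2) by (simp add: ennreal_log_plus_def del: ennreal_max_0 ennreal_max_0')
  finally show ?thesis .
qed

context linear_rds
begin

text \<open>Up to time \<open>1 - s\<close> the evolution from \<open>\<theta> s \<omega>\<close> is
  bounded by \<open>log_plus_sup\<close>; afterwards it factors through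
  \<open>\<theta> 1 \<omega>\<close>, whose constant applies. Hence the comparison looks forward in
  time, and \<open>exp \<bar>\<mu>\<bar>\<close> pays for a time shift of at most 1.\<close>

lemma growth_sup_step:
  fixes \<mu> :: real and \<Omega>\<^sub>0 :: "'w set" and E :: "'w \<Rightarrow> 'h set"
  assumes cont: "\<And>\<omega> x. \<omega> \<in> space M \<Longrightarrow> continuous_on {0..} (\<lambda>t. U t \<omega> x)"
    and inv: "invariant_full_measure M \<theta> \<Omega>\<^sub>0"
    and ne: "\<And>\<omega>. \<omega> \<in> \<Omega>\<^sub>0 \<Longrightarrow> E \<omega> \<noteq> {}"
    and E: "\<And>\<omega> t. \<omega> \<in> \<Omega>\<^sub>0 \<Longrightarrow> 0 \<le> t \<Longrightarrow> U t \<omega> ` E \<omega> \<subseteq> E (\<theta> t \<omega>)"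
    and bd: "\<And>\<omega>. \<omega> \<in> \<Omega>\<^sub>0 \<Longrightarrow> \<exists>c. \<forall>t\<ge>0. norm_on (U t \<omega>) (E \<omega>) \<le> c * exp (\<mu> * t)"
    and \<omega>: "\<omega> \<in> \<Omega>\<^sub>0" and s: "s \<in> {0..1}"
  defines "K \<equiv> \<lambda>\<omega>. growth_sup (\<lambda>t. U t \<omega>) (E \<omega>) \<mu>"
  shows "ennreal (ln (K (\<theta> s \<omega>))) \<le> ennreal (ln (K (\<theta> 1 \<omega>))) + (log_plus_sup \<theta> U \<omega> + ennreal \<bar>\<mu>\<bar>)"
proof (cases "log_plus_sup \<theta> U \<omega> = \<infinity>")
  case False
  define d where "d = enn2real (log_plus_sup \<theta> U \<omega>)"
  have d: "log_plus_sup \<theta> U \<omega> = ennreal d" "0 \<le> d"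
    using False by (auto simp: d_def less_top)
  have \<omega>M: "\<omega> \<in> space M" using invariant_full_measureD[OF inv] \<omega> by auto
  have \<theta>\<omega>: "\<theta> t \<omega> \<in> \<Omega>\<^sub>0" for t using flow_mem_invariant_iff[OF inv \<omega>M] \<omega> by simp
  have U_le: "norm (U t (\<theta> s \<omega>)) \<le> exp d" if "t \<in> {0..1}" for t
    unfolding d_def using norm_le_exp_log_plus_sup[of \<theta> U \<omega> t s] False that s by simp
  have K1: "1 \<le> K \<eta>" for \<eta> unfolding K_def by (rule growth_sup_ge_1)
  have exp_le: "exp (- \<mu> * t) \<le> exp \<bar>\<mu>\<bar>" if "t \<in> {0..1}" for t
  proof -
    have "- \<mu> * t \<le> \<bar>\<mu>\<bar> * t" using that by (intro mult_right_mono) auto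
    also have "\<dots> \<le> \<bar>\<mu>\<bar> * 1" using that by (intro mult_left_mono) auto
    finally show ?thesis by simp
  qed
  \<comment> \<open>Since \<open>growth_sup\<close> is cut off at 1, a competing constant has to be
    at least 1.\<close>
  have one: "1 \<le> K (\<theta> 1 \<omega>) * exp (d + \<bar>\<mu>\<bar>)"
    using mult_mono[OF K1[of "\<theta> 1 \<omega>"], of 1 "exp (d + \<bar>\<mu>\<bar>)"] K1[of "\<theta> 1 \<omega>"] d by simp
  have "norm_on (U t (\<theta> s \<omega>)) (E (\<theta> s \<omega>)) \<le> K (\<theta> 1 \<omega>) * exp (d + \<bar>\<mu>\<bar>) * exp (\<mu> * t)"
    if "0 \<le> t" for t
  proof (cases "t \<le> 1 - s")
    case True
    have t: "t \<in> {0..1}" using True \<open>0 \<le> t\<close> s by auto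
    have "norm_on (U t (\<theta> s \<omega>)) (E (\<theta> s \<omega>)) \<le> exp d"
      using norm_on_le_norm[OF ne[OF \<theta>\<omega>]] U_le[OF t] order_trans by blast
    also have "\<dots> = 1 * exp d * (exp (- \<mu> * t) * exp (\<mu> * t))"
      by (simp add: exp_minus)
    also have "\<dots> \<le> K (\<theta> 1 \<omega>) * exp d * (exp \<bar>\<mu>\<bar> * exp (\<mu> * t))"
      using K1[of "\<theta> 1 \<omega>"] exp_le[OF t] by (intro mult_mono) auto
    finally show ?thesis by (simp add: exp_add mult_ac)
  next
    case False
    \<comment> \<open>The time that remains after \<open>\<theta> 1 \<omega>\<close> has been
      reached.\<close>
    define v where "v = t - (1 - s)"
    have v: "0 \<le> v" "t = v + (1 - s)" "1 - s \<in> {0..1}"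
      using False s by (auto simp: v_def)
    have \<theta>1: "\<theta> (1 - s) (\<theta> s \<omega>) = \<theta> 1 \<omega>" using \<omega>M by (simp add: flow_add)
    have "U t (\<theta> s \<omega>) = U v (\<theta> 1 \<omega>) o\<^sub>L U (1 - s) (\<theta> s \<omega>)"
      unfolding v(2) \<theta>1[symmetric] using v \<omega>M s by (intro U_cocycle) (auto simp: flow_space)
    then have "norm_on (U t (\<theta> s \<omega>)) (E (\<theta> s \<omega>))
        \<le> norm_on (U v (\<theta> 1 \<omega>)) (E (\<theta> 1 \<omega>)) * norm_on (U (1 - s) (\<theta> s \<omega>)) (E (\<theta> s \<omega>))"
      using E[OF \<theta>\<omega>[of s], of "1 - s"] v ne[OF \<theta>\<omega>] unfolding \<theta>1 by (auto intro: norm_on_compose)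
    also have "\<dots> \<le> K (\<theta> 1 \<omega>) * exp (\<mu> * v) * exp d"
    proof (rule mult_mono)
      obtain c where "\<And>t. 0 \<le> t \<Longrightarrow> norm_on (U t (\<theta> 1 \<omega>)) (E (\<theta> 1 \<omega>)) \<le> c * exp (\<mu> * t)"
        using bd[OF \<theta>\<omega>] by blast
      then show "norm_on (U v (\<theta> 1 \<omega>)) (E (\<theta> 1 \<omega>)) \<le> K (\<theta> 1 \<omega>) * exp (\<mu> * v)"
        unfolding K_def
        using \<theta>\<omega> \<omega>M v(1) by (intro norm_on_le_growth_sup[OF ne cont]) (auto simp: flow_space)
      show "norm_on (U (1 - s) (\<theta> s \<omega>)) (E (\<theta> s \<omega>)) \<le> exp d"
        using norm_on_le_norm[OF ne[OF \<theta>\<omega>]] U_le[OF v(3)] order_trans by blast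
      show "0 \<le> K (\<theta> 1 \<omega>) * exp (\<mu> * v)" using K1[of "\<theta> 1 \<omega>"] by simp
    qed (rule norm_on_nonneg[OF ne[OF \<theta>\<omega>]])
    also have "\<dots> = K (\<theta> 1 \<omega>) * exp d * exp (\<mu> * t) * exp (- \<mu> * (1 - s))"
      by (simp add: v_def mult_exp_exp algebra_simps)
    also have "\<dots> \<le> K (\<theta> 1 \<omega>) * exp d * exp (\<mu> * t) * exp \<bar>\<mu>\<bar>"
      using K1[of "\<theta> 1 \<omega>"] by (intro mult_left_mono exp_le v) auto
    finally show ?thesis by (simp add: exp_add mult_ac)
  qed
  from growth_sup_least[OF one this] have "K (\<theta> s \<omega>) \<le> K (\<theta> 1 \<omega>) * exp (d + \<bar>\<mu>\<bar>)"
    unfolding K_def .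
  then have "ln (K (\<theta> s \<omega>)) \<le> ln (K (\<theta> 1 \<omega>) * exp (d + \<bar>\<mu>\<bar>))"
    using K1[of "\<theta> s \<omega>"] by (intro ln_mono) auto
  also have "\<dots> = ln (K (\<theta> 1 \<omega>)) + (d + \<bar>\<mu>\<bar>)"
    using K1[of "\<theta> 1 \<omega>"] by (simp add: ln_mult)
  finally have "ennreal (ln (K (\<theta> s \<omega>))) \<le> ennreal (ln (K (\<theta> 1 \<omega>)) + (d + \<bar>\<mu>\<bar>))"
    by (rule ennreal_leI)
  then show ?thesis
    using K1[of "\<theta> 1 \<omega>"] d by simp
qed simp

text \<open>By the cocycle property the norm at time \<open>t + s\<close> from \<omega> is at most
  \<open>exp b\<close> times the norm at time \<open>t\<close> from
  \<open>\<theta> s \<omega>\<close>. Dividing by \<open>exp b\<close> carries the lower bound at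
  \<omega> over to \<open>\<theta> s \<omega>\<close>.\<close>

lemma growth_inf_step:
  fixes r :: real and \<Omega>\<^sub>0 :: "'w set" and E :: "'w \<Rightarrow> 'h set"
  assumes cont: "\<And>\<omega> x. \<omega> \<in> space M \<Longrightarrow> continuous_on {0..} (\<lambda>t. U t \<omega> x)"
    and inv: "invariant_full_measure M \<theta> \<Omega>\<^sub>0"
    and dim: "\<And>\<omega>. \<omega> \<in> \<Omega>\<^sub>0 \<Longrightarrow> has_dimension (E \<omega>) d"
    and ne: "\<And>\<omega>. \<omega> \<in> \<Omega>\<^sub>0 \<Longrightarrow> E \<omega> \<noteq> {}"
    and E: "\<And>\<omega> t. \<omega> \<in> \<Omega>\<^sub>0 \<Longrightarrow> 0 \<le> t \<Longrightarrow> U t \<omega> ` E \<omega> \<subseteq> E (\<theta> t \<omega>)"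
    and \<omega>: "\<omega> \<in> \<Omega>\<^sub>0" and s: "s \<in> {0..1}"
  defines "K \<equiv> \<lambda>\<omega>. growth_inf (\<lambda>t. U t \<omega>) (E \<omega>) r"
  assumes pos: "\<And>\<omega>. \<omega> \<in> \<Omega>\<^sub>0 \<Longrightarrow> 0 < K \<omega>" and le1: "\<And>\<omega>. \<omega> \<in> \<Omega>\<^sub>0 \<Longrightarrow> K \<omega> \<le> 1"
  shows "ennreal (ln (inverse (K (\<theta> s \<omega>))))
    \<le> ennreal (ln (inverse (K \<omega>))) + (log_plus_sup \<theta> U \<omega> + ennreal \<bar>r\<bar>)"
proof (cases "log_plus_sup \<theta> U \<omega> = \<infinity>")
  case False
  define b where "b = enn2real (log_plus_sup \<theta> U \<omega>)"
  have b: "log_plus_sup \<theta> U \<omega> = ennreal b" "0 \<le> b"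
    using False by (auto simp: b_def less_top)
  have \<omega>M: "\<omega> \<in> space M" using invariant_full_measureD[OF inv] \<omega> by auto
  have \<theta>\<omega>: "\<theta> t \<omega> \<in> \<Omega>\<^sub>0" for t using flow_mem_invariant_iff[OF inv \<omega>M] \<omega> by simp
  have U_le: "norm (U s \<omega>) \<le> exp b"
    unfolding b_def using norm_le_exp_log_plus_sup[of \<theta> U \<omega> s 0] False s \<omega>M by (simp add: flow_zero)
  have exp_le: "exp (- \<bar>r\<bar>) \<le> exp (r * s)"
  proof -
    have "- \<bar>r\<bar> \<le> - \<bar>r\<bar> * s" using s mult_left_mono[of s 1 "\<bar>r\<bar>"] by simp
    also have "\<dots> \<le> r * s" using s by (intro mult_right_mono) auto
    finally show ?thesis by simp
  qed
  have "K \<omega> * exp (- b - \<bar>r\<bar>) * exp (r * t) \<le> norm_on (U t (\<theta> s \<omega>)) (E (\<theta> s \<omega>))"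
    if "0 \<le> t" for t
  proof -
    have "K \<omega> * exp (r * (t + s)) \<le> norm_on (U (t + s) \<omega>) (E \<omega>)"
      unfolding K_def using \<open>0 \<le> t\<close> s
      by (intro growth_inf_le_norm_on[OF dim[OF \<omega>] ne[OF \<omega>] cont[OF \<omega>M]]) auto
    also have "U (t + s) \<omega> = U t (\<theta> s \<omega>) o\<^sub>L U s \<omega>"
      using \<open>0 \<le> t\<close> s \<omega>M by (intro U_cocycle) auto
    also have "norm_on \<dots> (E \<omega>) \<le> norm_on (U t (\<theta> s \<omega>)) (E (\<theta> s \<omega>)) * norm_on (U s \<omega>) (E \<omega>)"
      using E[OF \<omega>, of s] s ne[OF \<omega>] by (intro norm_on_compose) auto
    also have "\<dots> \<le> norm_on (U t (\<theta> s \<omega>)) (E (\<theta> s \<omega>)) * exp b"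
      using norm_on_le_norm[OF ne[OF \<omega>], of "U s \<omega>"] U_le
      by (intro mult_left_mono norm_on_nonneg ne \<theta>\<omega>) auto
    finally have *: "K \<omega> * exp (r * (t + s)) \<le> norm_on (U t (\<theta> s \<omega>)) (E (\<theta> s \<omega>)) * exp b" .
    have "K \<omega> * exp (- b - \<bar>r\<bar>) * exp (r * t) = K \<omega> * exp (- b) * exp (r * t) * exp (- \<bar>r\<bar>)"
      by (simp add: mult_exp_exp algebra_simps)
    also have "\<dots> \<le> K \<omega> * exp (- b) * exp (r * t) * exp (r * s)"
      using pos[OF \<omega>] by (intro mult_left_mono exp_le) auto
    also have "\<dots> = K \<omega> * exp (r * (t + s)) * exp (- b)"
      by (simp add: mult_exp_exp algebra_simps)
    also have "\<dots> \<le> norm_on (U t (\<theta> s \<omega>)) (E (\<theta> s \<omega>)) * exp b * exp (- b)"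
      using * by (rule mult_right_mono) simp
    also have "\<dots> = norm_on (U t (\<theta> s \<omega>)) (E (\<theta> s \<omega>))"
      by (simp add: exp_minus)
    finally show ?thesis .
  qed
  from growth_inf_greatest[OF this] have "K \<omega> * exp (- b - \<bar>r\<bar>) \<le> K (\<theta> s \<omega>)"
    unfolding K_def .
  then have "ln (K \<omega> * exp (- b - \<bar>r\<bar>)) \<le> ln (K (\<theta> s \<omega>))"
    using pos[OF \<omega>] by (intro ln_mono) auto
  then have "ln (K \<omega>) + (- b - \<bar>r\<bar>) \<le> ln (K (\<theta> s \<omega>))"
    using pos[OF \<omega>] by (simp add: ln_mult)
  then have "ln (inverse (K (\<theta> s \<omega>))) \<le> ln (inverse (K \<omega>)) + (b + \<bar>r\<bar>)"
    using pos[OF \<omega>] pos[OF \<theta>\<omega>] by (simp add: ln_inverse)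
  then have "ennreal (ln (inverse (K (\<theta> s \<omega>)))) \<le> ennreal (ln (inverse (K \<omega>)) + (b + \<bar>r\<bar>))"
    by (rule ennreal_leI)
  \<comment> \<open>Both summands have to be nonnegative for \<open>ennreal\<close> to be additive
    on them.\<close>
  moreover have "0 \<le> ln (inverse (K \<omega>))"
    using pos[OF \<omega>] le1[OF \<omega>] by (simp add: ln_inverse)
  ultimately show ?thesis using b by simp
qed simp

lemma borel_measurable_norm_on_U:
  fixes P :: "'w \<Rightarrow> 'h \<Rightarrow>\<^sub>L 'h"
  assumes \<Omega>\<^sub>0: "\<Omega>\<^sub>0 \<in> sets M"
    and P: "\<And>x. (\<lambda>\<omega>. blinfun_apply (P \<omega>) x) \<in> borel_measurable (restrict_space M \<Omega>\<^sub>0)"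
      "\<And>\<omega>. \<omega> \<in> \<Omega>\<^sub>0 \<Longrightarrow> range (P \<omega>) = E \<omega>" and "0 \<le> t"
  shows "(\<lambda>\<omega>. norm_on (U t \<omega>) (E \<omega>)) \<in> borel_measurable (restrict_space M \<Omega>\<^sub>0)"
proof (rule borel_measurable_norm_on[OF P(1)])
  show "range (P \<omega>) = E \<omega>" if "\<omega> \<in> space (restrict_space M \<Omega>\<^sub>0)" for \<omega>
    using P(2) that by (simp add: space_restrict_space)
  fix x
  have "(\<lambda>\<omega>. (t, \<omega>, P \<omega> x)) \<in> restrict_space M \<Omega>\<^sub>0 \<rightarrow>\<^sub>M restrict_space borel {0..} \<Otimes>\<^sub>M M \<Otimes>\<^sub>M borel"
  proof (intro measurable_Pair)
    show "(\<lambda>\<omega>. t) \<in> restrict_space M \<Omega>\<^sub>0 \<rightarrow>\<^sub>M restrict_space borel {0..}"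
      using \<open>0 \<le> t\<close> by (intro measurable_const) (simp add: space_restrict_space)
    show "(\<lambda>\<omega>. \<omega>) \<in> restrict_space M \<Omega>\<^sub>0 \<rightarrow>\<^sub>M M"
      by (intro measurable_restrict_space1) simp
  qed (rule P(1))
  from measurable_compose[OF this U_measurable]
  show "(\<lambda>\<omega>. U t \<omega> (P \<omega> x)) \<in> borel_measurable (restrict_space M \<Omega>\<^sub>0)" by simp
qed

section \<open>The stable and the unstable estimate\<close>

text \<open>Uniform boundedness makes the supremum finite, rational times make it measurable, and
  comparison with the constant at \<open>\<theta> 1 \<omega>\<close> makes it tempered.\<close>

lemma stable_part:
  fixes P :: "'w \<Rightarrow> 'h \<Rightarrow>\<^sub>L 'h"
  assumes cont: "\<And>\<omega> x. \<omega> \<in> space M \<Longrightarrow> continuous_on {0..} (\<lambda>t. U t \<omega> x)"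
    and D: "log_plus_sup \<theta> U \<in> borel_measurable M" "(\<integral>\<^sup>+ \<omega>. log_plus_sup \<theta> U \<omega> \<partial>M) < \<infinity>"
    and inv: "invariant_full_measure M \<theta> \<Omega>\<^sub>0"
    and P: "\<And>x. (\<lambda>\<omega>. blinfun_apply (P \<omega>) x) \<in> borel_measurable (restrict_space M \<Omega>\<^sub>0)"
      "\<And>\<omega> x. \<omega> \<in> \<Omega>\<^sub>0 \<Longrightarrow> P \<omega> x \<in> E \<omega>" "\<And>\<omega> x. \<omega> \<in> \<Omega>\<^sub>0 \<Longrightarrow> x \<in> E \<omega> \<Longrightarrow> P \<omega> x = x"
    and E: "\<And>\<omega> t. \<omega> \<in> \<Omega>\<^sub>0 \<Longrightarrow> 0 \<le> t \<Longrightarrow> U t \<omega> ` E \<omega> \<subseteq> E (\<theta> t \<omega>)"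
    and growth: "\<And>\<omega> x. \<omega> \<in> \<Omega>\<^sub>0 \<Longrightarrow> x \<in> E \<omega> \<Longrightarrow>
      \<exists>\<tau>. \<forall>t\<ge>0. \<tau> \<le> t \<longrightarrow> norm (U t \<omega> x) \<le> norm x * exp (\<mu> * t)"
  shows "\<exists>K. tempered (restrict_space M \<Omega>\<^sub>0) \<theta> K \<and>
    (\<forall>t\<ge>0. \<forall>\<omega>\<in>\<Omega>\<^sub>0. norm_on (U t \<omega>) (E \<omega>) \<le> K \<omega> * exp (\<mu> * t))"
proof -
  note \<Omega>\<^sub>0 = invariant_full_measureD[OF inv]
  define K where "K \<omega> = growth_sup (\<lambda>t. U t \<omega>) (E \<omega>) \<mu>" for \<omega>
  have ne: "E \<omega> \<noteq> {}" if "\<omega> \<in> \<Omega>\<^sub>0" for \<omega> using P(2)[OF that] by blast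
  have bd: "\<exists>c. \<forall>t\<ge>0. norm_on (U t \<omega>) (E \<omega>) \<le> c * exp (\<mu> * t)" if "\<omega> \<in> \<Omega>\<^sub>0" for \<omega>
    using that \<Omega>\<^sub>0 by (intro growth_bound_if_pointwise[OF cont P(2,3) growth]) auto
  have range: "range (P \<omega>) = E \<omega>" if "\<omega> \<in> \<Omega>\<^sub>0" for \<omega>
    using P(2,3)[OF that] by (metis subsetI image_subsetI rangeI subset_antisym)
  have "K \<in> borel_measurable (restrict_space M \<Omega>\<^sub>0)"
    unfolding K_def growth_sup_def
  proof (intro borel_measurable_max borel_measurable_const borel_measurable_cSUP countable_nonneg_Rats
      borel_measurable_times borel_measurable_norm_on_U[OF \<Omega>\<^sub>0(1) P(1) range])
    fix \<omega> assume "\<omega> \<in> space (restrict_space M \<Omega>\<^sub>0)"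
    then have "\<omega> \<in> \<Omega>\<^sub>0" by (simp add: space_restrict_space)
    from bd[OF this] obtain c where "\<And>t. 0 \<le> t \<Longrightarrow> norm_on (U t \<omega>) (E \<omega>) \<le> c * exp (\<mu> * t)" by blast
    then show "bdd_above ((\<lambda>q. norm_on (U q \<omega>) (E \<omega>) * exp (- \<mu> * q)) ` ({0..} \<inter> \<rat>))"
      by (rule growth_sup_bdd_above)
  qed auto
  moreover have "1 \<le> K \<omega>" for \<omega> unfolding K_def by (rule growth_sup_ge_1)
  moreover have "(\<lambda>\<omega>. log_plus_sup \<theta> U \<omega> + ennreal \<bar>\<mu>\<bar>) \<in> borel_measurable M"
    using D(1) by measurable
  moreover have "(\<integral>\<^sup>+ \<omega>. log_plus_sup \<theta> U \<omega> + ennreal \<bar>\<mu>\<bar> \<partial>M) < \<infinity>"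
    using D by (simp add: nn_integral_add emeasure_space_1)
  moreover have "\<forall>s\<in>{0..1}. \<forall>\<omega>\<in>\<Omega>\<^sub>0. ennreal (ln (K (\<theta> s \<omega>)))
      \<le> ennreal (ln (K (\<theta> 1 \<omega>))) + (log_plus_sup \<theta> U \<omega> + ennreal \<bar>\<mu>\<bar>)"
    unfolding K_def by (intro ballI growth_sup_step[OF cont inv ne E bd])
  ultimately have "tempered (restrict_space M \<Omega>\<^sub>0) \<theta> K"
    by (intro tempered_restrict_spaceI[OF inv]) auto
  moreover have "norm_on (U t \<omega>) (E \<omega>) \<le> K \<omega> * exp (\<mu> * t)" if "0 \<le> t" "\<omega> \<in> \<Omega>\<^sub>0" for t \<omega>
  proof -
    obtain c where "\<And>t. 0 \<le> t \<Longrightarrow> norm_on (U t \<omega>) (E \<omega>) \<le> c * exp (\<mu> * t)"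
      using bd[OF \<open>\<omega> \<in> \<Omega>\<^sub>0\<close>] by blast
    then show ?thesis
      unfolding K_def using that \<Omega>\<^sub>0 by (intro norm_on_le_growth_sup[OF ne cont]) auto
  qed
  ultimately show ?thesis by blast
qed

text \<open>One nonzero vector makes the infimum positive, finite dimension extends its bound from
  rational to real times, and comparison with the constant at \<omega> makes its reciprocal
  tempered.\<close>

lemma unstable_part:
  fixes P :: "'w \<Rightarrow> 'h \<Rightarrow>\<^sub>L 'h"
  assumes cont: "\<And>\<omega> x. \<omega> \<in> space M \<Longrightarrow> continuous_on {0..} (\<lambda>t. U t \<omega> x)"
    and D: "log_plus_sup \<theta> U \<in> borel_measurable M" "(\<integral>\<^sup>+ \<omega>. log_plus_sup \<theta> U \<omega> \<partial>M) < \<infinity>"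
    and inv: "invariant_full_measure M \<theta> \<Omega>\<^sub>0"
    and P: "\<And>x. (\<lambda>\<omega>. blinfun_apply (P \<omega>) x) \<in> borel_measurable (restrict_space M \<Omega>\<^sub>0)"
      "\<And>\<omega> x. \<omega> \<in> \<Omega>\<^sub>0 \<Longrightarrow> P \<omega> x \<in> E \<omega>" "\<And>\<omega> x. \<omega> \<in> \<Omega>\<^sub>0 \<Longrightarrow> x \<in> E \<omega> \<Longrightarrow> P \<omega> x = x"
    and E: "\<And>\<omega> t. \<omega> \<in> \<Omega>\<^sub>0 \<Longrightarrow> 0 \<le> t \<Longrightarrow> U t \<omega> ` E \<omega> \<subseteq> E (\<theta> t \<omega>)"
    and dim: "\<And>\<omega>. \<omega> \<in> \<Omega>\<^sub>0 \<Longrightarrow> has_dimension (E \<omega>) d"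
    and nontrivial: "\<And>\<omega>. \<omega> \<in> \<Omega>\<^sub>0 \<Longrightarrow> \<exists>x\<in>E \<omega>. x \<noteq> 0"
    and nz: "\<And>\<omega> t x. \<omega> \<in> \<Omega>\<^sub>0 \<Longrightarrow> 0 \<le> t \<Longrightarrow> x \<in> E \<omega> \<Longrightarrow> x \<noteq> 0 \<Longrightarrow> U t \<omega> x \<noteq> 0"
    and growth: "\<And>\<omega> x. \<omega> \<in> \<Omega>\<^sub>0 \<Longrightarrow> x \<in> E \<omega> \<Longrightarrow>
      \<exists>\<tau>. \<forall>t\<ge>0. \<tau> \<le> t \<longrightarrow> norm x * exp (r * t) \<le> norm (U t \<omega> x)"
  shows "\<exists>K. tempered_from_below (restrict_space M \<Omega>\<^sub>0) \<theta> K \<and>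
    (\<forall>t\<ge>0. \<forall>\<omega>\<in>\<Omega>\<^sub>0. K \<omega> * exp (r * t) \<le> norm_on (U t \<omega>) (E \<omega>))"
proof -
  note \<Omega>\<^sub>0 = invariant_full_measureD[OF inv]
  define K where "K \<omega> = growth_inf (\<lambda>t. U t \<omega>) (E \<omega>) r" for \<omega>
  have ne: "E \<omega> \<noteq> {}" if "\<omega> \<in> \<Omega>\<^sub>0" for \<omega> using P(2)[OF that] by blast
  have range: "range (P \<omega>) = E \<omega>" if "\<omega> \<in> \<Omega>\<^sub>0" for \<omega>
    using P(2,3)[OF that] by (metis subsetI image_subsetI rangeI subset_antisym)
  have le: "K \<omega> * exp (r * t) \<le> norm_on (U t \<omega>) (E \<omega>)" if "0 \<le> t" "\<omega> \<in> \<Omega>\<^sub>0" for t \<omega>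
    unfolding K_def using that \<Omega>\<^sub>0 by (intro growth_inf_le_norm_on[OF dim ne cont]) auto
  \<comment> \<open>At time 0 the operator is the identity, so the reciprocal is at least 1 without
    a cut-off.\<close>
  have le1: "K \<omega> \<le> 1" if "\<omega> \<in> \<Omega>\<^sub>0" for \<omega>
  proof -
    have "K \<omega> \<le> norm_on (U 0 \<omega>) (E \<omega>)" using le[of 0] that by simp
    also have "\<dots> \<le> 1"
      using that \<Omega>\<^sub>0 by (intro norm_on_le ne) (auto simp: U_zero subset_iff)
    finally show ?thesis .
  qed
  have pos: "0 < K \<omega>" if \<omega>: "\<omega> \<in> \<Omega>\<^sub>0" for \<omega>
  proof -
    obtain x where x: "x \<in> E \<omega>" "x \<noteq> 0" using nontrivial[OF \<omega>] by blast
    obtain \<tau> where "\<And>t. 0 \<le> t \<Longrightarrow> \<tau> \<le> t \<Longrightarrow> norm x * exp (r * t) \<le> norm (U t \<omega> x)"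
      using growth[OF \<omega> x(1)] by blast
    then show ?thesis
      unfolding K_def using x nz[OF \<omega>] \<Omega>\<^sub>0 \<omega> by (intro growth_inf_pos[where x = x and \<tau> = \<tau>] cont) auto
  qed
  have K[measurable]: "K \<in> borel_measurable (restrict_space M \<Omega>\<^sub>0)"
    unfolding K_def growth_inf_def
  proof (intro borel_measurable_const borel_measurable_cINF countable_nonneg_Rats
      borel_measurable_times borel_measurable_norm_on_U[OF \<Omega>\<^sub>0(1) P(1) range])
    fix \<omega> assume "\<omega> \<in> space (restrict_space M \<Omega>\<^sub>0)"
    then have "\<omega> \<in> \<Omega>\<^sub>0" by (simp add: space_restrict_space)
    then show "bdd_below ((\<lambda>q. norm_on (U q \<omega>) (E \<omega>) * exp (- r * q)) ` ({0..} \<inter> \<rat>))"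
      by (intro bdd_belowI2[of _ 0] mult_nonneg_nonneg norm_on_nonneg ne) auto
  qed auto
  have "(\<lambda>\<omega>. log_plus_sup \<theta> U \<omega> + ennreal \<bar>r\<bar>) \<in> borel_measurable M"
    using D(1) by measurable
  moreover have "(\<integral>\<^sup>+ \<omega>. log_plus_sup \<theta> U \<omega> + ennreal \<bar>r\<bar> \<partial>M) < \<infinity>"
    using D by (simp add: nn_integral_add emeasure_space_1)
  moreover have "\<forall>s\<in>{0..1}. \<forall>\<omega>\<in>\<Omega>\<^sub>0. ennreal (ln (inverse (K (\<theta> s \<omega>))))
      \<le> ennreal (ln (inverse (K \<omega>))) + (log_plus_sup \<theta> U \<omega> + ennreal \<bar>r\<bar>)"
    using pos le1 unfolding K_def by (intro ballI growth_inf_step[OF cont inv dim ne E])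
  moreover have "1 \<le> inverse (K \<omega>)" if "\<omega> \<in> \<Omega>\<^sub>0" for \<omega>
    using pos[OF that] le1[OF that] by (simp add: one_le_inverse)
  moreover have "(\<lambda>\<omega>. inverse (K \<omega>)) \<in> borel_measurable (restrict_space M \<Omega>\<^sub>0)"
    by measurable
  ultimately have "tempered (restrict_space M \<Omega>\<^sub>0) \<theta> (\<lambda>\<omega>. inverse (K \<omega>))"
    by (intro tempered_restrict_spaceI[OF inv]) auto
  then have "tempered_from_below (restrict_space M \<Omega>\<^sub>0) \<theta> K"
    unfolding tempered_from_below_def using K pos by (auto simp: space_restrict_space)
  then show ?thesis using le by blast
qed

end

section \<open>Dimension and exponents: nontriviality of the unstable space\<close>

text \<open>An independent set does not contain 0, so \<open>{0}\<close> has only the empty basis.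
  As the dimension of \<open>Eu \<omega>\<close> is constant, triviality passes from one \<omega> to
  all others.\<close>

lemma has_dimension_trivial_iff:
  assumes "has_dimension E d"
  shows "E = {0} \<longleftrightarrow> d = 0"
proof -
  obtain B where B: "finite B" "card B = d" "independent B" "span B = E"
    using assms by (auto simp: has_dimension_def)
  have "B = {}" if "E = {0}"
  proof (rule ccontr)
    assume "B \<noteq> {}"
    then obtain b where "b \<in> B" by auto
    then have "b \<in> E" unfolding B(4)[symmetric] by (rule span_base)
    then have "0 \<in> B" using \<open>b \<in> B\<close> that by simp
    then show False using B(3) by (simp add: dependent_zero)
  qed
  moreover have "E = {0}" if "B = {}"
    using that B(4) by simp
  ultimately show ?thesis using B(1,2) by auto
qed

text \<open>The factor \<open>c\<close> disappears after taking logarithms and dividing by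
  \<open>t\<close>. Where \<open>h t = 0\<close> the logarithm is \<open>- \<infinity>\<close>;
  elsewhere the bound forces \<open>c\<close> to be positive.\<close>

lemma lyapunov_limit_le:
  fixes h :: "real \<Rightarrow> 'a::real_normed_vector"
  assumes lim: "((\<lambda>t. ereal (1 / t) * ereal_log (norm (h t))) \<longlongrightarrow> L) at_top"
    and le: "\<And>t. 0 \<le> t \<Longrightarrow> \<tau> \<le> t \<Longrightarrow> norm (h t) \<le> c * exp (\<mu> * t)"
  shows "L \<le> ereal \<mu>"
proof -
  have "ereal (1 / t) * ereal_log (norm (h t)) \<le> ereal (ln c / t + \<mu>)" if t: "0 < t" "\<tau> \<le> t" for t
  proof (cases "h t = 0")
    case False
    have h: "0 < norm (h t)" "norm (h t) \<le> c * exp (\<mu> * t)"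
      using le[of t] t False by auto
    then have "0 < c" by (smt (verit) exp_gt_zero mult_nonpos_nonneg)
    have "ln (norm (h t)) \<le> ln (c * exp (\<mu> * t))"
      using h by (intro ln_mono) auto
    also have "\<dots> = ln c + \<mu> * t" using \<open>0 < c\<close> by (simp add: ln_mult)
    finally have "ln (norm (h t)) / t \<le> ln c / t + \<mu>"
      using t by (simp add: field_simps)
    then show ?thesis using h by (simp add: ereal_log_def)
  qed (use t in \<open>simp add: ereal_log_def\<close>)
  then have ev: "\<forall>\<^sub>F t in at_top. ereal (1 / t) * ereal_log (norm (h t)) \<le> ereal (ln c / t + \<mu>)"
    by (intro eventually_mono[OF eventually_conj[OF eventually_gt_at_top[of 0] eventually_ge_at_top[of \<tau>]]]) auto
  have "((\<lambda>t. ln c / t + \<mu>) \<longlongrightarrow> 0 + \<mu>) at_top"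
    by (intro tendsto_add tendsto_const tendsto_divide_0[OF tendsto_const] filterlim_at_top_imp_at_infinity filterlim_ident)
  then have "((\<lambda>t. ereal (ln c / t + \<mu>)) \<longlongrightarrow> ereal \<mu>) at_top" by simp
  from tendsto_le[OF _ this lim ev] show ?thesis by simp
qed

text \<open>The random variables are chosen after \<epsilon>: they are the optimal constants for the
  rates \<open>lp - \<epsilon>\<close> and \<mu>, which change with \<epsilon>.\<close>

theorem theorem3p4:
  fixes M :: "'w measure"
    and \<theta> :: "real \<Rightarrow> 'w \<Rightarrow> 'w"
    and U :: "real \<Rightarrow> 'w \<Rightarrow> 'h::{real_inner, complete_space, second_countable_topology} \<Rightarrow>\<^sub>L 'h"
    and p :: enat and lam :: "nat \<Rightarrow> ereal" and V :: "nat \<Rightarrow> 'w \<Rightarrow> 'h set"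
    and l lp :: real and lm :: ereal
    and Eu Es :: "'w \<Rightarrow> 'h set" and Pu Ps :: "'w \<Rightarrow> 'h \<Rightarrow>\<^sub>L 'h"
    and \<Omega>V \<Omega>\<^sub>0 :: "'w set"
  assumes "linear_rds M \<theta> U"
    and "\<And>t \<omega>. 0 < t \<Longrightarrow> \<omega> \<in> space M \<Longrightarrow> compact_operator (U t \<omega>)"
    and "\<And>\<omega> x. \<omega> \<in> space M \<Longrightarrow> continuous_on {0..} (\<lambda>t. U t \<omega> x)"
    and "log_plus_sup \<theta> U \<in> borel_measurable M"
    and "(\<integral>\<^sup>+ \<omega>. log_plus_sup \<theta> U \<omega> \<partial>M) < \<infinity>"
    and "lyapunov_filtration M \<theta> U p lam V \<Omega>V"
    and "ereal l \<notin> lyapunov_spectrum p lam"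
    and "ereal l < lam 1"
    and "smallest_exponent_above (lyapunov_spectrum p lam) l lp"
    and "biggest_exponent_below (lyapunov_spectrum p lam) l lm"
    and "spectral_splitting M \<theta> U p lam V \<Omega>V lp lm Eu Es Pu Ps \<Omega>\<^sub>0"
  shows "\<exists>\<Omega>' \<subseteq> \<Omega>\<^sub>0. invariant_full_measure M \<theta> \<Omega>' \<and>
    (\<forall>\<epsilon>>0.
      (\<exists>Ku. tempered_from_below (restrict_space M \<Omega>') \<theta> Ku \<and>
        (\<forall>t\<ge>0. \<forall>\<omega>\<in>\<Omega>'. norm_on (U t \<omega>) (Eu \<omega>) \<ge> Ku \<omega> * exp ((lp - \<epsilon>) * t))) \<and>
      (\<forall>\<mu>. stable_rate lm \<epsilon> \<mu> \<longrightarrow>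
        (\<exists>Ks. tempered (restrict_space M \<Omega>') \<theta> Ks \<and>
          (\<forall>t\<ge>0. \<forall>\<omega>\<in>\<Omega>'. norm_on (U t \<omega>) (Es \<omega>) \<le> Ks \<omega> * exp (\<mu> * t)))))"
proof -
  interpret linear_rds M \<theta> U by fact
  note cont = assms(3)
  note split = assms(11)[unfolded spectral_splitting_def]
  have inv: "invariant_full_measure M \<theta> \<Omega>\<^sub>0" by (rule split[THEN conjunct1])
  note \<Omega>\<^sub>0 = invariant_full_measureD[OF inv]
  note Pu_meas = split[THEN conjunct2, THEN conjunct1, rule_format]
    and Ps_meas = split[THEN conjunct2, THEN conjunct2, THEN conjunct1, rule_format]
  obtain d where dim: "\<And>\<omega>. \<omega> \<in> \<Omega>\<^sub>0 \<Longrightarrow> has_dimension (Eu \<omega>) d"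
    using split[THEN conjunct2, THEN conjunct2, THEN conjunct2, THEN conjunct1] by blast
  note fibre = bspec[OF split[THEN conjunct2, THEN conjunct2, THEN conjunct2, THEN conjunct2]]
  note sub = fibre[THEN conjunct1] fibre[THEN conjunct2, THEN conjunct1]
    and decomp = fibre[THEN conjunct2, THEN conjunct2, THEN conjunct2, THEN conjunct1, rule_format]
    and proj = fibre[THEN conjunct2, THEN conjunct2, THEN conjunct2, THEN conjunct2, THEN conjunct1, THEN bspec, THEN bspec, THEN conjunct1]
      fibre[THEN conjunct2, THEN conjunct2, THEN conjunct2, THEN conjunct2, THEN conjunct1, THEN bspec, THEN bspec, THEN conjunct2]
    and bij = fibre[THEN conjunct2, THEN conjunct2, THEN conjunct2, THEN conjunct2, THEN conjunct2, THEN conjunct1, rule_format, THEN conjunct1]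
    and Es_inv = fibre[THEN conjunct2, THEN conjunct2, THEN conjunct2, THEN conjunct2, THEN conjunct2, THEN conjunct1, rule_format, THEN conjunct2]
    and rates = fibre[THEN conjunct2, THEN conjunct2, THEN conjunct2, THEN conjunct2, THEN conjunct2, THEN conjunct2, THEN conjunct2, rule_format]
  have Pu: "Pu \<omega> x \<in> Eu \<omega>" and Ps: "Ps \<omega> x \<in> Es \<omega>" if "\<omega> \<in> \<Omega>\<^sub>0" for \<omega> x
    using decomp[OF that, of x] proj[OF that] by auto
  have Pu_id: "Pu \<omega> x = x" if "\<omega> \<in> \<Omega>\<^sub>0" "x \<in> Eu \<omega>" for \<omega> x
    using proj(1)[OF that, of 0] sub(2)[OF that(1)] subspace_0 by force
  have Ps_id: "Ps \<omega> x = x" if "\<omega> \<in> \<Omega>\<^sub>0" "x \<in> Es \<omega>" for \<omega> x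
    using proj(2)[OF that(1) _ that(2), of 0] sub(1)[OF that(1)] subspace_0 by force

  have lp: "l < lp" and lp_le: "ereal lp \<le> lam 1"
  proof -
    have "lam 1 \<in> lyapunov_spectrum p lam"
      using assms(6) by (auto simp: lyapunov_spectrum_def exponent_indices_def lyapunov_filtration_def one_enat_def)
    then show "l < lp" "ereal lp \<le> lam 1"
      using assms(8,9) by (auto simp: smallest_exponent_above_def)
  qed
  have lm: "lm < ereal l"
    using assms(10) by (auto simp: biggest_exponent_below_def split: if_splits)
  text \<open>The splitting only controls small values of \<open>\<epsilon>\<close>; larger ones give weaker bounds.\<close>
  have small_rate: "\<exists>\<epsilon>'. 0 < \<epsilon>' \<and> \<epsilon>' \<le> \<epsilon> \<and> lm + ereal \<epsilon>' < ereal (lp - \<epsilon>')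
      \<and> (\<exists>\<mu>'. stable_rate lm \<epsilon>' \<mu>' \<and> \<mu>' < lp)
      \<and> (\<forall>\<mu>. stable_rate lm \<epsilon> \<mu> \<longrightarrow> (\<exists>\<mu>'\<le>\<mu>. stable_rate lm \<epsilon>' \<mu>'))"
    if "0 < \<epsilon>" for \<epsilon>
  proof (cases lm)
    case (real m)
    \<comment> \<open>A quarter of the gap keeps \<open>m + \<epsilon>'\<close> below
      \<open>lp - \<epsilon>'\<close>.\<close>
    define \<epsilon>' where "\<epsilon>' = min \<epsilon> ((lp - m) / 4)"
    have "m < lp" using lm lp real by simp
    then have "0 < \<epsilon>'" "\<epsilon>' \<le> \<epsilon>" using that by (auto simp: \<epsilon>'_def)
    moreover have "\<epsilon>' \<le> (lp - m) / 4" unfolding \<epsilon>'_def by (rule min.cobounded2)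
    then have "4 * \<epsilon>' \<le> lp - m" by (simp add: field_simps)
    ultimately have "m + \<epsilon>' < lp - \<epsilon>'" "m + \<epsilon>' < lp" "0 < \<epsilon>'" "\<epsilon>' \<le> \<epsilon>" by linarith+
    then show ?thesis
      using real by (intro exI[of _ \<epsilon>']) (auto simp: stable_rate_def intro!: exI[of _ "m + \<epsilon>'"])
  next
    case MInf
    \<comment> \<open>For \<open>lm = - \<infinity>\<close> every real number is a stable rate and
      the gap condition is automatic, so \<epsilon> itself serves; \<open>lp - 1\<close> is just
      some rate below \<open>lp\<close>.\<close>
    then have "stable_rate lm \<epsilon> (lp - 1)" "lm + ereal \<epsilon> < ereal (lp - \<epsilon>)"
      by (auto simp: stable_rate_def)
    moreover have "lp - 1 < lp" by simp
    ultimately show ?thesis using that by blast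
  qed (use lm in simp)

  \<comment> \<open>A vector outside the second space of the filtration has exponent
    \<open>lam 1 \<ge> lp\<close>. If the unstable space were trivial, this vector would be stable
    and have an exponent below \<open>lp\<close>.\<close>
  have Eu_ne: "Eu \<omega> \<noteq> {0}" if "\<omega> \<in> \<Omega>\<^sub>0" for \<omega>
  proof
    assume "Eu \<omega> = {0}"
    then have "d = 0" using has_dimension_trivial_iff[OF dim[OF that]] by simp
    \<comment> \<open>The point \<omega> may lie outside \<open>\<Omega>V\<close>. The contradiction
      is reached at a point \<eta> common to both sets of full measure, where the unstable space is
      trivial too, its dimension being constant.\<close>
    have "\<Omega>V \<in> sets M" "emeasure M \<Omega>V = 1"
      using assms(6) by (auto simp: lyapunov_filtration_def forward_invariant_full_measure_def full_measure_def)
    then have "AE \<eta> in M. \<eta> \<in> \<Omega>V" using prob_eq_1 by (simp add: emeasure_eq_measure)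
    moreover have "AE \<eta> in M. \<eta> \<in> \<Omega>\<^sub>0" using \<Omega>\<^sub>0 prob_eq_1 by (simp add: emeasure_eq_measure)
    ultimately have "AE \<eta> in M. \<eta> \<in> \<Omega>V \<and> \<eta> \<in> \<Omega>\<^sub>0" by eventually_elim simp
    moreover have "ae_filter M \<noteq> bot"
      by (simp add: ae_filter_eq_bot_iff emeasure_space_1)
    ultimately obtain \<eta> where \<eta>: "\<eta> \<in> \<Omega>V" "\<eta> \<in> \<Omega>\<^sub>0"
      using eventually_happens' by blast
    have one: "1 \<in> exponent_indices p"
      using assms(6) by (auto simp: exponent_indices_def lyapunov_filtration_def one_enat_def)
    note filt = bspec[OF assms(6)[unfolded lyapunov_filtration_def, THEN conjunct2, THEN conjunct2,
      THEN conjunct2, THEN conjunct2, THEN conjunct2, THEN conjunct2] one, THEN conjunct2]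
    have "V (Suc 1) \<eta> \<subset> V 1 \<eta>"
      by (rule filt[THEN conjunct1, rule_format, OF \<eta>(1)])
    then obtain x where x: "x \<in> V 1 \<eta> - V (Suc 1) \<eta>" by blast
    have lim: "((\<lambda>t. ereal (1 / t) * ereal_log (norm (U t \<eta> x))) \<longlongrightarrow> lam 1) at_top"
      by (rule filt[THEN conjunct2, THEN conjunct1, rule_format, OF \<eta>(1) x])
    have "Eu \<eta> = {0}" using has_dimension_trivial_iff[OF dim[OF \<eta>(2)]] \<open>d = 0\<close> by simp
    then have "x \<in> Es \<eta>" using decomp[OF \<eta>(2), of x] by auto
    \<comment> \<open>The choice of 1 is arbitrary: any stable rate below \<open>lp\<close> will
      do.\<close>
    obtain \<epsilon>' \<mu>' where *: "0 < \<epsilon>'" "lm + ereal \<epsilon>' < ereal (lp - \<epsilon>')" "stable_rate lm \<epsilon>' \<mu>'" "\<mu>' < lp"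
      using small_rate[of 1] by auto
    obtain \<tau> where "\<And>t. 0 \<le> t \<Longrightarrow> \<tau> \<le> t \<Longrightarrow> norm (U t \<eta> x) \<le> norm x * exp (\<mu>' * t)"
      using rates[OF \<eta>(2) *(1-3), of x] \<open>x \<in> Es \<eta>\<close> by blast
    from lyapunov_limit_le[OF lim this] have "lam 1 \<le> ereal \<mu>'" .
    then have "ereal lp \<le> ereal \<mu>'" using lp_le order_trans by blast
    then show False using *(4) by simp
  qed

  have "\<exists>Ku. tempered_from_below (restrict_space M \<Omega>\<^sub>0) \<theta> Ku \<and>
      (\<forall>t\<ge>0. \<forall>\<omega>\<in>\<Omega>\<^sub>0. Ku \<omega> * exp ((lp - \<epsilon>) * t) \<le> norm_on (U t \<omega>) (Eu \<omega>))" if "0 < \<epsilon>" for \<epsilon>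
  proof (rule unstable_part[OF cont assms(4,5) inv Pu_meas Pu Pu_id _ dim])
    obtain \<epsilon>' \<mu>' where *: "0 < \<epsilon>'" "\<epsilon>' \<le> \<epsilon>" "lm + ereal \<epsilon>' < ereal (lp - \<epsilon>')" "stable_rate lm \<epsilon>' \<mu>'"
      using small_rate[OF \<open>0 < \<epsilon>\<close>] by blast
    fix \<omega> assume \<omega>: "\<omega> \<in> \<Omega>\<^sub>0"
    show "U t \<omega> ` Eu \<omega> \<subseteq> Eu (\<theta> t \<omega>)" if "0 \<le> t" for t
      using bij[OF \<omega> that] by (simp add: bij_betw_def)
    show "\<exists>x\<in>Eu \<omega>. x \<noteq> 0"
      using Eu_ne[OF \<omega>] subspace_0[OF sub(1)[OF \<omega>]] by blast
    show "U t \<omega> x \<noteq> 0" if "0 \<le> t" "x \<in> Eu \<omega>" "x \<noteq> 0" for t x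
      using bij[OF \<omega> that(1)] subspace_0[OF sub(1)[OF \<omega>]] that
      by (metis bij_betw_def blinfun.zero_right inj_onD)
    show "\<exists>\<tau>. \<forall>t\<ge>0. \<tau> \<le> t \<longrightarrow> norm x * exp ((lp - \<epsilon>) * t) \<le> norm (U t \<omega> x)" if x: "x \<in> Eu \<omega>" for x
    proof -
      obtain \<tau> where \<tau>: "\<And>t. 0 \<le> t \<Longrightarrow> \<tau> \<le> t \<Longrightarrow> norm x * exp ((lp - \<epsilon>') * t) \<le> norm (U t \<omega> x)"
        using rates[OF \<omega> *(1,3,4), of x] x by blast
      have "norm x * exp ((lp - \<epsilon>) * t) \<le> norm x * exp ((lp - \<epsilon>') * t)" if "0 \<le> t" for t
        using *(2) that by (auto intro!: mult_left_mono mult_right_mono)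
      then show ?thesis using \<tau> order_trans by blast
    qed
  qed
  moreover have "\<exists>Ks. tempered (restrict_space M \<Omega>\<^sub>0) \<theta> Ks \<and>
      (\<forall>t\<ge>0. \<forall>\<omega>\<in>\<Omega>\<^sub>0. norm_on (U t \<omega>) (Es \<omega>) \<le> Ks \<omega> * exp (\<mu> * t))"
    if "0 < \<epsilon>" "stable_rate lm \<epsilon> \<mu>" for \<epsilon> \<mu>
  proof (rule stable_part[OF cont assms(4,5) inv Ps_meas Ps Ps_id Es_inv])
    obtain \<epsilon>' \<mu>' where *: "0 < \<epsilon>'" "lm + ereal \<epsilon>' < ereal (lp - \<epsilon>')" "stable_rate lm \<epsilon>' \<mu>'" "\<mu>' \<le> \<mu>"
      using small_rate[OF \<open>0 < \<epsilon>\<close>] \<open>stable_rate lm \<epsilon> \<mu>\<close> by blast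
    fix \<omega> x assume \<omega>: "\<omega> \<in> \<Omega>\<^sub>0" and x: "x \<in> Es \<omega>"
    obtain \<tau> where \<tau>: "\<And>t. 0 \<le> t \<Longrightarrow> \<tau> \<le> t \<Longrightarrow> norm (U t \<omega> x) \<le> norm x * exp (\<mu>' * t)"
      using rates[OF \<omega> *(1-3), of x] x by blast
    have "norm x * exp (\<mu>' * t) \<le> norm x * exp (\<mu> * t)" if "0 \<le> t" for t
      using *(4) that by (auto intro!: mult_left_mono mult_right_mono)
    then show "\<exists>\<tau>. \<forall>t\<ge>0. \<tau> \<le> t \<longrightarrow> norm (U t \<omega> x) \<le> norm x * exp (\<mu> * t)"
      using \<tau> order_trans by blast
  qed
  \<comment> \<open>All of \<open>\<Omega>\<^sub>0\<close> can be kept: the estimates hold at each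
    of its points, and each random variable has its own invariant subset on which the limit in
    temperedness is taken.\<close>
  ultimately show ?thesis
    using inv by (intro exI[of _ \<Omega>\<^sub>0]) auto
qed

end
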